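(* There exists a universal constant $C>0$ such that the following holds for all real numbers $d,A$ satisfying, with $\mu:=Ad$, $$0<d<\frac{20}{399},\qquad \sqrt{1+4d^2}<\mu\le 1+\frac{d}{10},$$ and for every unit vector $p=(p_1,p_2)\in\mathbb R^2$. Set $$r_\mu:=\arccos\frac1\mu,\qquad \mathcal D_\mu:=[\pi-r_\mu,\pi+r_\mu]\times\{0\},\qquad x_{\mathrm f}:=\left(\frac{\pi}{2},0\right),$$ and let $G_+^p$ be the viscosity solution of $$(G_+^p)_t+H_+(x,DG_+^p)=0\ \text{ on }\mathbb R^2\times(0,\infty),\qquad G_+^p(x,0)=p\cdot x,$$ where $$H_+(x,q)=\left(1+d\,\frac{q^{\mathsf T}S_{V_A}(x)q}{|q|^2}\right)_+|q|+V_A(x)\cdot q\quad(q\ne0),\qquad H_+(x,0)=0.$$ Then: (i) $G_+^p(x,t)\ge \pi p_1-r_\mu|p_1|$ for all $x\in\mathcal D_\mu$ and $t\ge 0$; (ii) $\displaystyle\liminf_{t\to\infty}-\frac{G_+^p(x_{\mathrm f},t)}{t}\ge C\frac{A}{\log A}$; (iii) for $u^p(x,t)=G_+^p(x,t)-p\cdot x$, $$\liminf_{t\to\infty}\frac{\operatorname{osc}_{\mathbb T^2_{2\pi}}u^p(\cdot,t)}{t}\ge C\frac{A}{\log A}.$$ In particular, no phase-independent effective burning velocity exists: there is no real number $\overline H(p)$ such that $(G_+^p(x,t)-p\cdot x)/t\to-\overline H(p)$ uniformly in $x\in\mathbb R^2$ as $t\to\infty$. The constant $C$ does not depend on $p$,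 $A$, or $d$.
   Context: $\mathbb T^2_{2\pi}=(\mathbb R/2\pi\mathbb Z)^2$; functions on it are identified with $2\pi\mathbb Z^2$-periodic functions on $\mathbb R^2$. The cellular flow is $V_0(x_1,x_2)=(-\sin x_1\cos x_2,\ \cos x_1\sin x_2)$ and $V_A=AV_0$. For a $C^1$ vector field $V$, $S_V=(DV+DV^{\mathsf T})/2$; here $S_{V_A}(x)=A\,\mathrm{diag}(-\Phi(x),\Phi(x))$ with $\Phi(x)=\cos x_1\cos x_2$. $(a)_+=\max\{a,0\}$. $\operatorname{osc}f=\sup f-\inf f$. "The viscosity solution" with initial datum $p\cdot x$ means the unique continuous viscosity solution on $\mathbb R^2\times[0,\infty)$ in the planar periodic class, i.e. such that $G(x,t)-p\cdot x$ is $2\pi\mathbb Z^2$-periodic in $x$. Convention: an upper semicontinuous $G$ is a viscosity subsolution of $G_t+H(x,DG)=0$ if $\varphi_t+H(x_0,D\varphi)\le0$ at $(x_0,t_0)$, $t_0>0$, whenever $\varphi\in C^1$ and $G-\varphi$ has a local maximum at $(x_0,t_0)$; a lower semicontinuous $G$ is a supersolution if the reverse inequality holds at local minima; a solution is both. *)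

theory Defs
  imports "HOL-Analysis.Analysis"
begin

section \<open>Viscosity solutions of \<open>G\<^sub>t + H(x, D G) = 0\<close>\<close>

text \<open>Space-time functions are functions of a pair \<open>(x, t)\<close>; only their values at \<open>t \<ge> 0\<close> matter.
  \<open>g\<close> is the spatial gradient of \<open>\<phi>\<close> and \<open>h\<close> its time derivative.\<close>

definition C1_with ::
    "('a::euclidean_space \<times> real) set \<Rightarrow> ('a \<times> real \<Rightarrow> real) \<Rightarrow> ('a \<times> real \<Rightarrow> 'a) \<Rightarrow> ('a \<times> real \<Rightarrow> real) \<Rightarrow> bool"
  where "C1_with S \<phi> g h \<longleftrightarrow>
    continuous_on S g \<and> continuous_on S h \<and>
    (\<forall>z\<in>S. (\<phi> has_derivative (\<lambda>(y, s). g z \<bullet> y + h z * s)) (at z))"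

definition usc_on :: "'a::topological_space set \<Rightarrow> ('a \<Rightarrow> real) \<Rightarrow> bool"
  where "usc_on S f \<longleftrightarrow> (\<forall>z\<in>S. \<forall>c>f z. \<forall>\<^sub>F y in at z within S. f y < c)"

definition lsc_on :: "'a::topological_space set \<Rightarrow> ('a \<Rightarrow> real) \<Rightarrow> bool"
  where "lsc_on S f \<longleftrightarrow> (\<forall>z\<in>S. \<forall>c<f z. \<forall>\<^sub>F y in at z within S. c < f y)"

definition local_max_at :: "('a::topological_space \<Rightarrow> real) \<Rightarrow> 'a \<Rightarrow> bool"
  where "local_max_at f z \<longleftrightarrow> (\<forall>\<^sub>F y in nhds z. f y \<le> f z)"

definition local_min_at :: "('a::topological_space \<Rightarrow> real) \<Rightarrow> 'a \<Rightarrow> bool"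
  where "local_min_at f z \<longleftrightarrow> (\<forall>\<^sub>F y in nhds z. f z \<le> f y)"

definition pos_time :: "('a::euclidean_space \<times> real) set"
  where "pos_time = UNIV \<times> {0<..}"

definition visc_subsolution ::
    "('a::euclidean_space \<Rightarrow> 'a \<Rightarrow> real) \<Rightarrow> ('a \<times> real \<Rightarrow> real) \<Rightarrow> bool"
  where "visc_subsolution H G \<longleftrightarrow> usc_on pos_time G \<and>
    (\<forall>\<phi> g h x t. C1_with pos_time \<phi> g h \<and> t > 0 \<and> local_max_at (\<lambda>z. G z - \<phi> z) (x, t)
        \<longrightarrow> h (x, t) + H x (g (x, t)) \<le> 0)"

definition visc_supersolution ::
    "('a::euclidean_space \<Rightarrow> 'a \<Rightarrow> real) \<Rightarrow> ('a \<times> real \<Rightarrow> real) \<Rightarrow> bool"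
  where "visc_supersolution H G \<longleftrightarrow> lsc_on pos_time G \<and>
    (\<forall>\<phi> g h x t. C1_with pos_time \<phi> g h \<and> t > 0 \<and> local_min_at (\<lambda>z. G z - \<phi> z) (x, t)
        \<longrightarrow> h (x, t) + H x (g (x, t)) \<ge> 0)"

definition visc_solution ::
    "('a::euclidean_space \<Rightarrow> 'a \<Rightarrow> real) \<Rightarrow> ('a \<times> real \<Rightarrow> real) \<Rightarrow> bool"
  where "visc_solution H G \<longleftrightarrow> visc_subsolution H G \<and> visc_supersolution H G"

text \<open>Functions on the torus are identified with periodic functions on the plane.\<close>

definition periodic_2pi :: "(real^2 \<Rightarrow> real) \<Rightarrow> bool"
  where "periodic_2pi f \<longleftrightarrow>
    (\<forall>x. \<forall>m n :: int. f (x + vector [2 * pi * of_int m, 2 * pi * of_int n]) = f x)"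

definition planar_visc_solution ::
    "(real^2 \<Rightarrow> real^2 \<Rightarrow> real) \<Rightarrow> real^2 \<Rightarrow> ((real^2) \<times> real \<Rightarrow> real) \<Rightarrow> bool"
  where "planar_visc_solution H p G \<longleftrightarrow>
    continuous_on (UNIV \<times> {0..}) G \<and>
    visc_solution H G \<and>
    (\<forall>x. G (x, 0) = p \<bullet> x) \<and>
    (\<forall>t\<ge>0. periodic_2pi (\<lambda>x. G (x, t) - p \<bullet> x))"

text \<open>On the reals \<open>SUP\<close> and \<open>INF\<close> are meaningful only for bounded \<open>f\<close>, in particular
  for continuous periodic ones.\<close>

definition osc :: "(real^2 \<Rightarrow> real) \<Rightarrow> real"
  where "osc f = (SUP x. f x) - (INF x. f x)"


section \<open>The cellular flow and the strain Hamiltonian\<close>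

definition cell_flow :: "real \<Rightarrow> real^2 \<Rightarrow> real^2"
  where "cell_flow A x = A *\<^sub>R vector [- sin (x$1) * cos (x$2), cos (x$1) * sin (x$2)]"

definition strain :: "(real^'n \<Rightarrow> real^'n) \<Rightarrow> real^'n \<Rightarrow> real^'n^'n"
  where "strain V x = (1/2) *\<^sub>R (jacobian V (at x) + transpose (jacobian V (at x)))"

definition H_plus :: "real \<Rightarrow> real \<Rightarrow> real^2 \<Rightarrow> real^2 \<Rightarrow> real"
  where "H_plus d A x q =
    (if q = 0 then 0
     else max (1 + d * (q \<bullet> (strain (cell_flow A) x *v q)) / (norm q)\<^sup>2) 0 * norm q
          + cell_flow A x \<bullet> q)"

definition r_angle :: "real \<Rightarrow> real"
  where "r_angle \<mu> = arccos (1 / \<mu>)"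

definition D_seg :: "real \<Rightarrow> (real^2) set"
  where "D_seg \<mu> = {x. x$1 \<in> {pi - r_angle \<mu> .. pi + r_angle \<mu>} \<and> x$2 = 0}"

definition x_f :: "real^2"
  where "x_f = vector [pi / 2, 0]"

lemma strain_cell_flow:
  "strain (cell_flow A) x =
     A *\<^sub>R vector [vector [- (cos (x$1) * cos (x$2)), 0], vector [0, cos (x$1) * cos (x$2)]]"
proof -
  define M :: "real^2^2" where "M = A *\<^sub>R vector
     [vector [- (cos (x$1) * cos (x$2)), sin (x$1) * sin (x$2)],
      vector [- (sin (x$1) * sin (x$2)), cos (x$1) * cos (x$2)]]"
  have "(cell_flow A has_derivative (\<lambda>h. M *v h)) (at x)"
    unfolding has_derivative_componentwise_within[of "cell_flow A"]
  proof
    fix b :: "real^2" assume "b \<in> Basis"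
    then obtain i where b: "b = axis i 1" by (auto simp: Basis_vec_def)
    have nth: "((\<lambda>x::real^2. x $ k) has_derivative (\<lambda>h. h $ k)) (at x)" for k
      by (rule bounded_linear_imp_has_derivative[OF bounded_linear_vec_nth])
    have "i = 1 \<or> i = 2" by (rule exhaust_2)
    then show "((\<lambda>y. cell_flow A y \<bullet> b) has_derivative (\<lambda>h. (M *v h) \<bullet> b)) (at x)"
      by (elim disjE)
        (auto simp: b cell_flow_def M_def inner_axis matrix_vector_mult_def sum_2 algebra_simps
          intro!: derivative_eq_intros nth ext)
  qed
  then have "jacobian (cell_flow A) (at x) = M"
    by (metis frechet_derivative_at jacobian_def matrix_of_matrix_vector_mul)
  then show ?thesis
    by (simp add: strain_def M_def vec_eq_iff forall_2 transpose_def)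
qed

end

theory Submission
  imports Defs
begin

text \<open>Write \<open>V\<close> for the cellular flow of amplitude \<open>A\<close>, \<open>\<mu> = A d\<close>, \<open>r = arccos (1/\<mu>)\<close> and
  \<open>\<Phi> x = cos x\<^sub>1 cos x\<^sub>2\<close>. The two ingredients are a lower bound for \<open>G\<close> on the segment around the
  stagnation point \<open>(\<pi>, 0)\<close> and an upper bound, decreasing linearly in time, at the edge midpoint
  \<open>(\<pi>/2, 0)\<close>. The estimate of the oscillation and the absence of a common limit then follow by
  comparing the two points.

  The lower bound (\<open>lower_bound_on_segment\<close>) is a comparison with the smooth strict subsolution
  \<open>m - \<epsilon> - \<epsilon> t - M s\<^sup>2 - K e\<^sup>\<rho>\<^sup>t x\<^sub>2\<^sup>2\<close>, where \<open>s\<close> is the distance of \<open>x\<^sub>1\<close> from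
  \<open>[\<pi> - r, \<pi> + r]\<close> and \<open>m\<close> is the minimum of \<open>p \<bullet> x\<close> over the segment. On the segment
  \<open>1 + \<mu>\<Phi> \<le> 0\<close>, so vertical gradients do not burn there; above and below it they do so only to second order
  in \<open>x\<^sub>2\<close>, which is paid for by the exponential growth. Just beyond an end of the segment, horizontal
  gradients burn with speed at most \<open>2\<close>, while the opposing drift has at least the speed \<open>A sin r\<close> on the
  axis. For \<open>\<mu> > 1\<close> the inequality \<open>A sin r > 2\<close> is equivalent to \<open>\<mu> > sqrt (1 + 4 d\<^sup>2)\<close>.

  For the upper bound, the Hamiltonian is at least \<open>V x \<bullet> q + a x |q|\<close> with
  \<open>a = max (1 - \<mu>|\<Phi>|) 0\<close>. Hence \<open>G\<close> is nonincreasing along every curve whose velocity differs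
  from \<open>V\<close> by at most \<open>a\<close> (\<open>subsolution_nonincreasing_along_curve\<close>). Near the midpoint of a
  cell edge \<open>a\<close> is bounded below, and in the passage time of order \<open>1/A\<close> such a curve can leave the
  separatrix and reach a stream line at level \<open>\<kappa>\<close> of order \<open>1/A\<close>. Following that stream line past
  the corner takes a time of order \<open>(log A)/A\<close>, and the mirror image of the first half, with time reversed,
  leads to the midpoint of the next edge (\<open>reach_quarter_turn\<close>). By the symmetries of the flow all such quarter turns
  are equivalent, and at most eight of them join \<open>(\<pi>/2, 0)\<close> to its translate by one period in any of
  the four coordinate directions (\<open>reach_one_period\<close>). For one of these directions \<open>p \<bullet> x\<close> grows by
  at least \<open>\<pi>\<close>, so that by periodicity \<open>G\<close> at \<open>(\<pi>/2, 0)\<close> drops by at least \<open>\<pi>\<close> in a time of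
  order \<open>(log A)/A\<close>.\<close>

section \<open>Auxiliary calculus\<close>

lemma DERIV_max_zero_power2: "((\<lambda>u::real. (max u 0)\<^sup>2) has_real_derivative 2 * max u 0) (at u)"
proof -
  consider "u < 0" | "u = 0" | "u > 0" by linarith
  then show ?thesis
  proof cases
    case 1
    have "((\<lambda>u::real. 0) has_real_derivative 0) (at u)" by simp
    then have "((\<lambda>u::real. (max u 0)\<^sup>2) has_real_derivative 0) (at u)"
      by (rule has_field_derivative_transform_within_open[of _ _ _ "{..<0}"]) (use 1 in auto)
    then show ?thesis using 1 by simp
  next
    case 3
    have "((\<lambda>u::real. u\<^sup>2) has_real_derivative 2 * u) (at u)"
      by (auto intro!: derivative_eq_intros)
    then have "((\<lambda>u::real. (max u 0)\<^sup>2) has_real_derivative 2 * u) (at u)"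
      by (rule has_field_derivative_transform_within_open[of _ _ _ "{0<..}"]) (use 3 in auto)
    then show ?thesis using 3 by simp
  next
    case 2
    have "((\<lambda>h::real. (max h 0)\<^sup>2 / h) \<longlongrightarrow> 0) (at 0)"
    proof (rule Lim_null_comparison)
      show "\<forall>\<^sub>F h::real in at 0. norm ((max h 0)\<^sup>2 / h) \<le> \<bar>h\<bar>"
        by (auto simp: max_def power2_eq_square eventually_at_filter)
      show "((\<lambda>h::real. \<bar>h\<bar>) \<longlongrightarrow> 0) (at 0)"
        by (rule tendsto_eq_intros | simp)+
    qed
    then show ?thesis using 2 by (simp add: DERIV_def)
  qed
qed

lemma antiderivative_on_UNIV:
  fixes f :: "real \<Rightarrow> 'a::banach"
  assumes "continuous_on UNIV f"
  obtains F where "\<And>t. (F has_vector_derivative f t) (at t)"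
proof -
  define F where "F t = integral {0..t} f - integral {t..0} f" for t
  have "(F has_vector_derivative f t) (at t)" for t
  proof -
    define M where "M = \<bar>t\<bar> + 1"
    have cM: "continuous_on {-M..M} f" by (rule continuous_on_subset[OF assms]) simp
    have iM: "f integrable_on {u..v}" for u v
      by (rule integrable_continuous_real) (rule continuous_on_subset[OF assms], simp)
    have eq: "F u = integral {-M..u} f - integral {-M..0} f" if "u \<in> {-M<..<M}" for u
    proof (cases "u \<ge> 0")
      case True
      then have "integral {-M..0} f + integral {0..u} f = integral {-M..u} f"
        using that by (intro Henstock_Kurzweil_Integration.integral_combine iM) auto
      moreover have "integral {u..0} f = 0" using True by (cases "u = 0") auto
      ultimately show ?thesis unfolding F_def by (simp add: algebra_simps)
    next
      case False
      then have "integral {-M..u} f + integral {u..0} f = integral {-M..0} f"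
        using that by (intro Henstock_Kurzweil_Integration.integral_combine iM) auto
      then show ?thesis using False unfolding F_def by (simp add: algebra_simps)
    qed
    have "((\<lambda>u. integral {-M..u} f) has_vector_derivative f t) (at t within {-M..M})"
      by (rule integral_has_vector_derivative[OF cM]) (auto simp: M_def)
    moreover have "at t within {-M..M} = at t"
      by (rule at_within_interior) (auto simp: M_def)
    ultimately have "((\<lambda>u. integral {-M..u} f - integral {-M..0} f) has_vector_derivative f t) (at t)"
      by (auto intro!: derivative_eq_intros)
    then show ?thesis
      by (rule has_vector_derivative_transform_within_open[of _ _ _ "{-M<..<M}"])
        (auto simp: M_def eq)
  qed
  then show ?thesis using that by blast
qed

lemma abs_sin_diff_le: "\<bar>sin x - sin y\<bar> \<le> \<bar>x - y\<bar>" for x y :: real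
proof -
  have "\<bar>sin x - sin y\<bar> = 2 * \<bar>sin ((x - y) / 2)\<bar> * \<bar>cos ((x + y) / 2)\<bar>"
    by (simp add: sin_diff_sin abs_mult)
  also have "\<dots> \<le> 2 * \<bar>(x - y) / 2\<bar> * 1"
    by (intro mult_mono abs_sin_x_le_abs_x abs_cos_le_one mult_left_mono) auto
  finally show ?thesis by simp
qed

lemma abs_cos_diff_le: "\<bar>cos x - cos y\<bar> \<le> \<bar>x - y\<bar>" for x y :: real
  using abs_sin_diff_le[of "x + pi/2" "y + pi/2"] by (simp add: sin_add)

lemma abs_mult_diff_le:
  fixes a b c e :: real
  assumes "\<bar>b\<bar> \<le> 1" "\<bar>c\<bar> \<le> 1"
  shows "\<bar>a * b - c * e\<bar> \<le> \<bar>a - c\<bar> + \<bar>b - e\<bar>"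
proof -
  have "a * b - c * e = (a - c) * b + c * (b - e)" by (simp add: algebra_simps)
  also have "\<bar>\<dots>\<bar> \<le> \<bar>(a - c) * b\<bar> + \<bar>c * (b - e)\<bar>" by (rule abs_triangle_ineq)
  also have "\<dots> \<le> \<bar>a - c\<bar> * 1 + 1 * \<bar>b - e\<bar>"
    unfolding abs_mult by (intro add_mono mult_mono assms) auto
  finally show ?thesis by simp
qed

lemma half_le_sin:
  fixes x :: real
  assumes "0 \<le> x" "x \<le> pi / 2"
  shows "x / 2 \<le> sin x"
proof (cases "x \<le> pi / 3")
  case True
  have "(\<lambda>x. sin x - x / 2) 0 \<le> (\<lambda>x. sin x - x / 2) x"
  proof (rule DERIV_nonneg_imp_nondecreasing[OF assms(1)])
    fix y assume y: "0 \<le> y" "y \<le> x"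
    have "cos y \<ge> 1 / 2"
      using cos_monotone_0_pi_le[of y "pi/3"] y True by (simp add: cos_60)
    then show "\<exists>z. ((\<lambda>x. sin x - x / 2) has_real_derivative z) (at y) \<and> 0 \<le> z"
      by (intro exI[of _ "cos y - 1/2"]) (auto intro!: derivative_eq_intros)
  qed
  then show ?thesis by simp
next
  case False
  have "sin (pi/3) \<le> sin x"
    using sin_monotone_2pi_le[of "pi/3" x] False assms by simp
  moreover have "8/5 \<le> sqrt 3" by (rule real_le_rsqrt) (simp add: power2_eq_square)
  moreover have "x / 2 \<le> 4/5" using assms pi_approx by simp
  ultimately show ?thesis by (simp add: sin_60)
qed

lemma quadratic_dominates:
  fixes c \<delta> N y :: real
  assumes "0 \<le> c" "0 < \<delta>" "\<delta> \<le> y" "c / \<delta>\<^sup>2 + 1 / \<delta> \<le> N"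
  shows "c + y \<le> N * y\<^sup>2"
proof -
  have "c = c / \<delta>\<^sup>2 * \<delta>\<^sup>2" using assms by simp
  also have "\<dots> \<le> c / \<delta>\<^sup>2 * y\<^sup>2" using assms by (intro mult_left_mono power_mono) auto
  finally have 1: "c \<le> c / \<delta>\<^sup>2 * y\<^sup>2" .
  have "y = 1 / \<delta> * (\<delta> * y)" using assms by simp
  also have "\<dots> \<le> 1 / \<delta> * (y * y)" using assms by (intro mult_left_mono mult_right_mono) auto
  finally have 2: "y \<le> 1 / \<delta> * y\<^sup>2" by (simp add: power2_eq_square)
  have "c + y \<le> (c / \<delta>\<^sup>2 + 1 / \<delta>) * y\<^sup>2" using 1 2 by (simp add: distrib_right)
  also have "\<dots> \<le> N * y\<^sup>2" using assms by (intro mult_right_mono) auto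
  finally show ?thesis .
qed

lemma linear_le_quadratic:
  fixes \<epsilon> N y :: real
  assumes "0 < \<epsilon>" "1 / (2 * \<epsilon>) \<le> N"
  shows "y \<le> \<epsilon> / 2 + N * y\<^sup>2"
proof -
  have "0 \<le> (y - \<epsilon>)\<^sup>2 / (2 * \<epsilon>)" using assms by simp
  also have "\<dots> = \<epsilon> / 2 + 1 / (2 * \<epsilon>) * y\<^sup>2 - y"
    using assms by (simp add: power2_eq_square field_simps)
  finally have "y \<le> \<epsilon> / 2 + 1 / (2 * \<epsilon>) * y\<^sup>2" by simp
  also have "\<dots> \<le> \<epsilon> / 2 + N * y\<^sup>2" using assms by (intro add_left_mono mult_right_mono) auto
  finally show ?thesis .
qed

lemma vec2_eq: "(x::real^2) = y \<longleftrightarrow> x$1 = y$1 \<and> x$2 = y$2"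
  by (simp add: vec_eq_iff forall_2)

lemma inner_vec2: "(x::real^2) \<bullet> y = x$1 * y$1 + x$2 * y$2"
  by (simp add: inner_vec_def sum_2)

lemma norm_power2_vec2: "(norm (x::real^2))\<^sup>2 = (x$1)\<^sup>2 + (x$2)\<^sup>2"
  using power2_norm_eq_inner[of x] by (simp add: inner_vec2 power2_eq_square)

lemma norm_le_abs2: "norm (x::real^2) \<le> \<bar>x$1\<bar> + \<bar>x$2\<bar>"
  using norm_le_l1_cart[of x] by (simp add: sum_2)

lemma coordinate_diff_le: "\<bar>(x::real^2)$1 - y$1\<bar> + \<bar>x$2 - y$2\<bar> \<le> 2 * norm (x - y)"
  using component_le_norm_cart[of "x - y" 1] component_le_norm_cart[of "x - y" 2] by simp

lemma vector_2_eq_axes: "(vector [a, b] :: real^2) = a *\<^sub>R axis 1 1 + b *\<^sub>R axis 2 1"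
  by (simp add: vec2_eq axis_def)

lemma has_vector_derivative_vec2:
  assumes "(f has_real_derivative f') (at s within S)" "(g has_real_derivative g') (at s within S)"
  shows "((\<lambda>s. vector [f s, g s] :: real^2) has_vector_derivative vector [f', g']) (at s within S)"
  unfolding vector_2_eq_axes using assms
  by (auto intro!: derivative_eq_intros simp: has_real_derivative_iff_has_vector_derivative)

text \<open>Separation of variables: the inverse of \<open>\<theta> \<mapsto> \<integral> 1/l\<close> solves \<open>g' = l g\<close> and runs from
  \<open>a\<close> to \<open>b\<close> in time \<open>\<tau> = \<integral>\<^sub>a\<^sup>b 1/l\<close>. The last conclusion bounds this time by the increment of any function
  whose derivative is at least \<open>1/l\<close>.\<close>

lemma autonomous_ode_solution:
  fixes l :: "real \<Rightarrow> real"
  assumes ab: "a < b" and contl: "continuous_on {a..b} l" and posl: "\<And>\<theta>. \<theta> \<in> {a..b} \<Longrightarrow> 0 < l \<theta>"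
  obtains \<tau> g where "0 \<le> \<tau>" "g 0 = a" "g \<tau> = b" "\<And>s. s \<in> {0..\<tau>} \<Longrightarrow> g s \<in> {a..b}"
    "\<And>s. s \<in> {0..\<tau>} \<Longrightarrow> (g has_real_derivative l (g s)) (at s within {0..\<tau>})"
    "\<And>B B'. (\<And>\<theta>. \<theta> \<in> {a..b} \<Longrightarrow> (B has_real_derivative B' \<theta>) (at \<theta>) \<and> 1 / l \<theta> \<le> B' \<theta>)
        \<Longrightarrow> \<tau> \<le> B b - B a"
proof -
  define cl where "cl \<theta> = max a (min b \<theta>)" for \<theta>
  have cl: "cl \<theta> \<in> {a..b}" for \<theta> using ab by (auto simp: cl_def)
  define w where "w \<theta> = 1 / l (cl \<theta>)" for \<theta>
  have w0: "w \<theta> > 0" for \<theta> using posl[OF cl] by (simp add: w_def)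
  have "continuous_on UNIV (\<lambda>\<theta>. l (cl \<theta>))"
    by (rule continuous_on_compose2[OF contl]) (use cl in \<open>auto simp: cl_def intro!: continuous_intros\<close>)
  moreover have "l (cl \<theta>) \<noteq> 0" for \<theta> using posl[OF cl[of \<theta>]] by simp
  ultimately have "continuous_on UNIV w"
    unfolding w_def by (intro continuous_intros) auto
  then obtain F where F: "\<And>t. (F has_vector_derivative w t) (at t)"
    by (rule antiderivative_on_UNIV) blast
  define S where "S \<theta> = F \<theta> - F a" for \<theta>
  have S': "(S has_real_derivative w \<theta>) (at \<theta>)" for \<theta>
    using F[of \<theta>] unfolding S_def
    by (auto intro!: derivative_eq_intros simp: has_real_derivative_iff_has_vector_derivative)
  have S_less: "S x < S y" if "x < y" for x y
    by (rule DERIV_pos_imp_increasing[OF that]) (use S' w0 in blast)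
  have injS: "inj S" by (metis S_less inj_def linorder_neqE_linordered_idom order_less_irrefl)
  have S_cont: "isCont S x" for x using S' DERIV_isCont by blast
  have S_hits: "\<exists>z\<ge>x. z \<le> y \<and> S z = s" if "S x \<le> s" "s \<le> S y" "x \<le> y" for x y s
    using IVT'[of S x s y] that S_cont by (auto intro: continuous_at_imp_continuous_on)
  define g where "g = inv S"
  have gS: "g (S z) = z" for z unfolding g_def using injS by simp
  have g': "(g has_real_derivative l (cl x)) (at (S x))" for x
  proof -
    have "isCont g (S x)"
      by (rule isCont_inverse_function[where d = 1]) (auto simp: gS S_cont)
    moreover have "S (g y) = y" if y: "S (x - 1) < y" "y < S (x + 1)" for y
    proof -
      obtain z where "S z = y" using S_hits[of "x - 1" y "x + 1"] y by auto
      then show ?thesis using gS[of z] by simp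
    qed
    ultimately have "(g has_real_derivative inverse (w x)) (at (S x))"
      using S'[of x] w0[of x] S_less[of "x - 1" x] S_less[of x "x + 1"]
      by (intro DERIV_inverse_function[where a = "S (x - 1)" and b = "S (x + 1)" and f = S]) (auto simp: gS)
    then show ?thesis by (simp add: w_def)
  qed
  have Sa: "S a = 0" by (simp add: S_def)
  show ?thesis
  proof (rule that[of "S b" g])
    show "0 \<le> S b" using S_less[OF ab] Sa by simp
    show "g 0 = a" using gS[of a] Sa by simp
    show "g (S b) = b" by (rule gS)
    fix s assume s: "s \<in> {0..S b}"
    then obtain z where z: "a \<le> z" "z \<le> b" "S z = s"
      using S_hits[of a s b] Sa ab by auto
    then have "g s = z" using gS by auto
    then show "g s \<in> {a..b}" using z by simp
    have "cl z = z" using z by (simp add: cl_def)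
    then show "(g has_real_derivative l (g s)) (at s within {0..S b})"
      using g'[of z] z \<open>g s = z\<close> by (auto intro: has_field_derivative_at_within)
  next
    fix B B' :: "real \<Rightarrow> real"
    assume B: "\<And>\<theta>. \<theta> \<in> {a..b} \<Longrightarrow> (B has_real_derivative B' \<theta>) (at \<theta>) \<and> 1 / l \<theta> \<le> B' \<theta>"
    have "(\<lambda>x. B x - S x) a \<le> (\<lambda>x. B x - S x) b"
    proof (rule DERIV_nonneg_imp_nondecreasing[of a b])
      show "a \<le> b" using ab by simp
      fix x assume x: "a \<le> x" "x \<le> b"
      have "((\<lambda>x. B x - S x) has_real_derivative B' x - w x) (at x)"
        using B[of x] x by (intro DERIV_diff S') auto
      moreover have "B' x - w x \<ge> 0" using B[of x] x by (simp add: w_def cl_def)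
      ultimately show "\<exists>y. ((\<lambda>x. B x - S x) has_real_derivative y) (at x) \<and> 0 \<le> y" by blast
    qed
    then show "S b \<le> B b - B a" using Sa by simp
  qed
qed

lemma Liminf_at_top_ge:
  fixes f :: "real \<Rightarrow> real"
  assumes "\<And>t. 0 < t \<Longrightarrow> a - b / t \<le> f t"
  shows "ereal a \<le> Liminf at_top (\<lambda>t. ereal (f t))"
proof -
  have "((\<lambda>t. a - b / t) \<longlongrightarrow> a - 0) at_top"
    by (intro tendsto_diff tendsto_const real_tendsto_divide_at_top[OF tendsto_const filterlim_ident])
  then have "((\<lambda>t. ereal (a - b / t)) \<longlongrightarrow> ereal a) at_top" by simp
  then have "ereal a = Liminf at_top (\<lambda>t. ereal (a - b / t))"
    by (intro lim_imp_Liminf[symmetric]) simp_all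
  also have "\<dots> \<le> Liminf at_top (\<lambda>t. ereal (f t))"
    by (rule Liminf_mono) (use assms in \<open>auto intro: eventually_mono[OF eventually_gt_at_top[of 0]]\<close>)
  finally show ?thesis .
qed

lemma periodic_drop_imp_linear_decay:
  fixes h :: "real \<Rightarrow> real"
  assumes \<tau>: "0 < \<tau>" and c: "0 \<le> c" and drop: "\<And>t. 0 \<le> t \<Longrightarrow> h (t + \<tau>) \<le> h t - c"
    and B: "\<And>t. t \<in> {0..\<tau>} \<Longrightarrow> h t \<le> B" and t: "0 \<le> t"
  shows "h t \<le> B + c - c / \<tau> * t"
proof -
  have iter: "h (s + real n * \<tau>) \<le> h s - real n * c" if "0 \<le> s" for s n
  proof (induction n)
    case (Suc n)
    have "h (s + real (Suc n) * \<tau>) = h ((s + real n * \<tau>) + \<tau>)" by (simp add: algebra_simps)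
    also have "\<dots> \<le> h (s + real n * \<tau>) - c" using drop that \<tau> by simp
    finally show ?case using Suc by (simp add: algebra_simps)
  qed simp
  define n where "n = nat \<lfloor>t / \<tau>\<rfloor>"
  have n: "real n \<le> t / \<tau>" "t / \<tau> < real n + 1"
    using t \<tau> unfolding n_def by (simp_all add: floor_correct)
  then have s: "t - real n * \<tau> \<in> {0..\<tau>}" using \<tau> by (simp add: field_simps)
  have "h t \<le> h (t - real n * \<tau>) - real n * c" using iter[of "t - real n * \<tau>" n] s by simp
  also have "\<dots> \<le> B - real n * c" using B[OF s] by simp
  also have "\<dots> \<le> B - (t / \<tau> - 1) * c" using n c by (intro diff_left_mono mult_right_mono) auto
  finally show ?thesis by (simp add: algebra_simps)
qed

section \<open>Comparison of viscosity subsolutions with smooth barriers\<close>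

text \<open>The barrier has to be strict only where it lies below \<open>G\<close>. No doubling of variables is needed since
  the barrier is itself a test function. The maximum is kept away from the final time by adding
  a multiple of the \<open>C\<^sup>1\<close> function \<open>max (s - t) 0 ^ 2\<close> of the time \<open>s\<close>, which vanishes up to \<open>t\<close>
  and whose time derivative has the favourable sign.\<close>

lemma comparison_below_barrier:
  fixes G \<phi> :: "'a::euclidean_space \<times> real \<Rightarrow> real"
  assumes contG: "continuous_on (UNIV \<times> {0..}) G"
    and sub: "visc_subsolution H G"
    and C1: "C1_with pos_time \<phi> g h"
    and cont\<phi>: "continuous_on (UNIV \<times> {0..}) \<phi>"
    and t0: "0 \<le> t0"
    and init: "\<And>x. G (x, t0) \<le> \<phi> (x, t0)"
    and far: "\<And>x t. t0 \<le> t \<Longrightarrow> t \<le> T \<Longrightarrow> R \<le> norm x \<Longrightarrow> G (x, t) \<le> \<phi> (x, t)"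
    and strict: "\<And>x t. t0 < t \<Longrightarrow> t < T \<Longrightarrow> \<phi> (x, t) < G (x, t) \<Longrightarrow> h (x, t) + H x (g (x, t)) > 0"
    and t: "t0 \<le> t" "t < T"
  shows "G (x, t) \<le> \<phi> (x, t)"
proof (rule ccontr)
  assume "\<not> G (x, t) \<le> \<phi> (x, t)"
  then have bad: "G (x, t) > \<phi> (x, t)" by simp
  define K where "K = cball (0::'a) R \<times> {t0..T}"
  have compK: "compact K" unfolding K_def by (intro compact_Times) auto
  have K0: "K \<subseteq> UNIV \<times> {0..}" using t0 unfolding K_def by auto
  have cd: "continuous_on K (\<lambda>z. G z - \<phi> z)"
    by (intro continuous_on_diff continuous_on_subset[OF contG K0] continuous_on_subset[OF cont\<phi> K0])
  have xR: "norm x < R" using far[of t x] t bad by force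
  have inK: "(x, t) \<in> K" using xR t unfolding K_def by simp
  obtain z0 where z0: "z0 \<in> K" "\<And>z. z \<in> K \<Longrightarrow> G z - \<phi> z \<le> G z0 - \<phi> z0"
    using continuous_attains_sup[OF compK _ cd] inK by blast
  \<comment> \<open>large enough for the modified barrier to dominate \<open>G\<close> at the final time \<open>T\<close>\<close>
  define L where "L = (G z0 - \<phi> z0) / (T - t)\<^sup>2"
  have L0: "L \<ge> 0" using z0(2)[OF inK] bad unfolding L_def by simp
  define \<psi> where "\<psi> z = \<phi> z + L * (max (snd z - t) 0)\<^sup>2" for z :: "'a \<times> real"
  have c\<psi>: "continuous_on K (\<lambda>z. G z - \<psi> z)"
    unfolding \<psi>_def
    by (intro continuous_intros continuous_on_subset[OF contG K0] continuous_on_subset[OF cont\<phi> K0])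
  obtain y s where ys: "(y, s) \<in> K" and ymax: "\<And>z. z \<in> K \<Longrightarrow> G z - \<psi> z \<le> G (y, s) - \<psi> (y, s)"
    using continuous_attains_sup[OF compK _ c\<psi>] inK by (metis empty_iff surj_pair)
  have pos: "G (y, s) - \<psi> (y, s) > 0"
    using ymax[OF inK] bad by (simp add: \<psi>_def)
  have \<phi>\<psi>: "\<phi> z \<le> \<psi> z" for z unfolding \<psi>_def using L0 by simp
  have lt: "\<phi> (y, s) < G (y, s)" using pos \<phi>\<psi>[of "(y, s)"] by linarith
  have s: "t0 \<le> s" "s \<le> T" "norm y \<le> R" using ys unfolding K_def by auto
  have "s \<noteq> t0" using lt init[of y] by auto
  moreover have "s \<noteq> T"
  proof
    assume "s = T"
    then have "\<psi> (y, s) = \<phi> (y, s) + (G z0 - \<phi> z0)"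
      using t unfolding \<psi>_def L_def by simp
    then show False using z0(2)[OF ys] pos by linarith
  qed
  moreover have "norm y \<noteq> R" using far[of s y] s lt by auto
  ultimately have s': "t0 < s" "s < T" "norm y < R" using s by auto
  have "open (ball (0::'a) R \<times> {t0<..<T})" by (intro open_Times) auto
  then have "\<forall>\<^sub>F z in nhds (y, s). z \<in> ball (0::'a) R \<times> {t0<..<T}"
    by (rule eventually_nhds_in_open) (use s' in auto)
  then have lm: "local_max_at (\<lambda>z. G z - \<psi> z) (y, s)"
    unfolding local_max_at_def
    by (rule eventually_mono) (rule ymax, auto simp: K_def)
  have C1': "C1_with pos_time \<psi> g (\<lambda>z. h z + L * (2 * max (snd z - t) 0))"
    unfolding C1_with_def
  proof (intro conjI ballI)
    show "continuous_on pos_time g" using C1 by (simp add: C1_with_def)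
    show "continuous_on pos_time (\<lambda>z. h z + L * (2 * max (snd z - t) 0))"
      using C1 by (auto simp: C1_with_def intro!: continuous_intros)
    fix z :: "'a \<times> real" assume z: "z \<in> pos_time"
    have d1: "(\<phi> has_derivative (\<lambda>(y, s). g z \<bullet> y + h z * s)) (at z)"
      using C1 z by (simp add: C1_with_def)
    have "((\<lambda>z::'a\<times>real. snd z - t) has_derivative snd) (at z)"
      by (auto intro!: derivative_eq_intros)
    from has_derivative_compose[OF this, of "\<lambda>u. (max u 0)\<^sup>2" "(*) (2 * max (snd z - t) 0)"]
    have d2: "((\<lambda>z. (max (snd z - t) 0)\<^sup>2) has_derivative (\<lambda>y. 2 * max (snd z - t) 0 * snd y)) (at z)"
      using DERIV_max_zero_power2 by (simp add: has_field_derivative_def)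
    show "(\<psi> has_derivative (\<lambda>(y, s). g z \<bullet> y + (h z + L * (2 * max (snd z - t) 0)) * s)) (at z)"
      unfolding \<psi>_def
      by (rule has_derivative_eq_rhs[OF has_derivative_add[OF d1 has_derivative_mult_right[OF d2]]])
        (auto simp: fun_eq_iff algebra_simps)
  qed
  have "s > 0" using s' t0 by simp
  then have "h (y, s) + L * (2 * max (s - t) 0) + H y (g (y, s)) \<le> 0"
    using sub C1' lm unfolding visc_subsolution_def by fastforce
  moreover have "L * (2 * max (s - t) 0) \<ge> 0" using L0 by simp
  ultimately show False using strict[OF s'(1,2) lt] by linarith
qed

lemma visc_subsolution_minus:
  assumes "visc_supersolution H G"
  shows "visc_subsolution (\<lambda>x q. - H x (- q)) (\<lambda>z. - G z)"
  unfolding visc_subsolution_def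
proof (intro conjI allI impI)
  have "\<forall>z\<in>pos_time. \<forall>c<G z. \<forall>\<^sub>F y in at z within pos_time. c < G y"
    using assms by (simp add: visc_supersolution_def lsc_on_def)
  then show "usc_on pos_time (\<lambda>z. - G z)"
    unfolding usc_on_def
    by (metis (no_types, lifting) eventually_mono minus_less_iff)
next
  fix \<phi> g h x t
  assume *: "C1_with pos_time \<phi> g h \<and> 0 < t \<and> local_max_at (\<lambda>z. - G z - \<phi> z) (x, t)"
  have C: "C1_with pos_time (\<lambda>z. - \<phi> z) (\<lambda>z. - g z) (\<lambda>z. - h z)"
    unfolding C1_with_def
  proof (intro conjI ballI)
    show "continuous_on pos_time (\<lambda>z. - g z)" "continuous_on pos_time (\<lambda>z. - h z)"
      using * by (auto simp: C1_with_def intro: continuous_on_minus)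
    fix z :: "'a \<times> real" assume "z \<in> pos_time"
    then have "(\<phi> has_derivative (\<lambda>(y, s). g z \<bullet> y + h z * s)) (at z)"
      using * by (simp add: C1_with_def)
    from has_derivative_minus[OF this]
    show "((\<lambda>z. - \<phi> z) has_derivative (\<lambda>(y, s). - g z \<bullet> y + - h z * s)) (at z)"
      by (rule has_derivative_eq_rhs) (auto simp: fun_eq_iff)
  qed
  have "local_min_at (\<lambda>z. G z - (- \<phi> z)) (x, t)"
    using * unfolding local_max_at_def local_min_at_def
    by (auto elim!: eventually_mono)
  then have "- h (x, t) + H x (- g (x, t)) \<ge> 0"
    using assms C * unfolding visc_supersolution_def by blast
  then show "h (x, t) + - H x (- g (x, t)) \<le> 0" by simp
qed

section \<open>Boundedness of planar solutions\<close>

lemma planar_visc_solution_bounded: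
  assumes "planar_visc_solution H p G"
  obtains B where "0 \<le> B" "\<And>x t. t \<in> {0..T} \<Longrightarrow> \<bar>G (x, t) - p \<bullet> x\<bar> \<le> B"
proof -
  define K :: "((real^2) \<times> real) set" where "K = cbox (vector [0, 0]) (vector [2 * pi, 2 * pi]) \<times> {0..T}"
  have "compact K" unfolding K_def by (intro compact_Times) auto
  moreover have "continuous_on K (\<lambda>z. G z - p \<bullet> fst z)"
  proof (rule continuous_on_diff)
    have "continuous_on (UNIV \<times> {0..}) G" using assms by (simp add: planar_visc_solution_def)
    then show "continuous_on K G" by (rule continuous_on_subset) (auto simp: K_def)
  qed (intro continuous_intros)
  ultimately have "bounded ((\<lambda>z. G z - p \<bullet> fst z) ` K)"
    using compact_continuous_image compact_imp_bounded by blast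
  then obtain B where B: "\<And>z. z \<in> K \<Longrightarrow> \<bar>G z - p \<bullet> fst z\<bar> \<le> B"
    unfolding bounded_iff by auto
  have "\<bar>G (x, t) - p \<bullet> x\<bar> \<le> \<bar>B\<bar>" if t: "t \<in> {0..T}" for x t
  proof -
    define m n where "m = - \<lfloor>x$1 / (2 * pi)\<rfloor>" and "n = - \<lfloor>x$2 / (2 * pi)\<rfloor>"
    define y where "y = x + vector [2 * pi * of_int m, 2 * pi * of_int n]"
    have box: "0 \<le> u + 2 * pi * of_int (- \<lfloor>u / (2 * pi)\<rfloor>)" "u + 2 * pi * of_int (- \<lfloor>u / (2 * pi)\<rfloor>) \<le> 2 * pi" for u
    proof -
      have "u + 2 * pi * of_int (- \<lfloor>u / (2 * pi)\<rfloor>) = 2 * pi * (u / (2 * pi) - of_int \<lfloor>u / (2 * pi)\<rfloor>)"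
        by (simp add: right_diff_distrib)
      moreover have "0 \<le> u / (2 * pi) - of_int \<lfloor>u / (2 * pi)\<rfloor>" "u / (2 * pi) - of_int \<lfloor>u / (2 * pi)\<rfloor> \<le> 1"
        by linarith+
      ultimately show "0 \<le> u + 2 * pi * of_int (- \<lfloor>u / (2 * pi)\<rfloor>)" "u + 2 * pi * of_int (- \<lfloor>u / (2 * pi)\<rfloor>) \<le> 2 * pi"
        using mult_left_mono[of _ 1 "2 * pi"] by simp_all
    qed
    have "(y, t) \<in> K"
      using box[of "x$1"] box[of "x$2"] t
      by (simp add: K_def mem_box_cart forall_2 y_def m_def n_def)
    moreover have "G (y, t) - p \<bullet> y = G (x, t) - p \<bullet> x"
      using assms t unfolding planar_visc_solution_def periodic_2pi_def y_def by auto
    ultimately show ?thesis using B[of "(y, t)"] by simp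
  qed
  then show ?thesis using that[of "\<bar>B\<bar>"] by simp
qed

section \<open>Monotonicity along controlled curves\<close>

text \<open>Up to an error that is Lipschitz in the distance from the curve, the Hamiltonian is bounded below by
  the linear one whose characteristic is \<open>\<gamma>\<close>. The barrier \<open>N e\<^sup>2\<^sup>L\<^sup>t |x - \<gamma> t|\<^sup>2\<close>, plus a constant and a
  small multiple of \<open>t\<close>, absorbs this error.\<close>

lemma subsolution_nonincreasing_along_curve:
  fixes G :: "'a::euclidean_space \<times> real \<Rightarrow> real"
  assumes contG: "continuous_on (UNIV \<times> {0..}) G"
    and sub: "visc_subsolution H G"
    and growth: "\<And>T. \<exists>B. \<forall>x. \<forall>t\<in>{0..T}. G (x, t) \<le> B + norm x"
    and contv: "continuous_on {0..\<tau>} v"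
    and deriv: "\<And>s. s \<in> {0..\<tau>} \<Longrightarrow> (\<gamma> has_vector_derivative v s) (at s within {0..\<tau>})"
    and L: "L \<ge> 0"
    and ham: "\<And>s x q. s \<in> {0..\<tau>} \<Longrightarrow> H x q \<ge> v s \<bullet> q - L * norm (x - \<gamma> s) * norm q"
    and \<tau>: "0 \<le> \<tau>" and t0: "0 \<le> t0"
  shows "G (\<gamma> \<tau>, t0 + \<tau>) \<le> G (\<gamma> 0, t0)"
proof (cases "\<tau> = 0")
  case True then show ?thesis by simp
next
  case False
  with \<tau> have \<tau>: "\<tau> > 0" by simp
  \<comment> \<open>Test functions are defined for all positive times, so the curve is continued beyond \<open>[0, \<tau>]\<close>
    with the velocities that it has at its ends.\<close>
  define cl where "cl s = max 0 (min \<tau> (s - t0))" for s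
  have cl: "cl s \<in> {0..\<tau>}" for s using \<tau> by (auto simp: cl_def)
  have "continuous_on UNIV (\<lambda>s. v (cl s))"
    by (rule continuous_on_compose2[OF contv]) (use cl in \<open>auto simp: cl_def intro!: continuous_intros\<close>)
  then obtain F where F: "\<And>t. (F has_vector_derivative v (cl t)) (at t)"
    by (rule antiderivative_on_UNIV) blast
  define y where "y t = F t - F t0 + \<gamma> 0" for t
  have y': "(y has_vector_derivative v (cl t)) (at t)" for t
    unfolding y_def by (auto intro!: derivative_eq_intros F)
  have y\<gamma>: "y (t0 + s) = \<gamma> s" if "s \<in> {0..\<tau>}" for s
  proof -
    have 1: "((\<lambda>s. y (t0 + s) - \<gamma> s) has_vector_derivative 0) (at s within {0..\<tau>})" if "s \<in> {0..\<tau>}" for s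
    proof -
      have "((\<lambda>s. t0 + s) has_vector_derivative 1) (at s within {0..\<tau>})"
        by (auto intro!: derivative_eq_intros)
      moreover have "(y has_vector_derivative v (cl (t0 + s))) (at (t0 + s) within (+) t0 ` {0..\<tau>})"
        by (rule has_vector_derivative_at_within[OF y'])
      ultimately have "((y \<circ> (\<lambda>s. t0 + s)) has_vector_derivative 1 *\<^sub>R v (cl (t0 + s))) (at s within {0..\<tau>})"
        by (rule vector_diff_chain_within)
      moreover have "cl (t0 + s) = s" using that by (auto simp: cl_def)
      ultimately show ?thesis
        using deriv[OF that] by (auto intro!: derivative_eq_intros simp: o_def)
    qed
    have "\<exists>c. \<forall>s\<in>{0..\<tau>}. y (t0 + s) - \<gamma> s = c"
      by (rule has_vector_derivative_zero_constant[of "{0..\<tau>}" "\<lambda>s. y (t0 + s) - \<gamma> s"]) (use 1 in auto)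
    then obtain c where "\<And>s. s \<in> {0..\<tau>} \<Longrightarrow> y (t0 + s) - \<gamma> s = c" by blast
    from this[of 0] this[OF that] show ?thesis using \<tau> by (simp add: y_def)
  qed
  have yc: "continuous_on S y" for S
    by (meson y' has_vector_derivative_continuous continuous_at_imp_continuous_on)
  have clc: "continuous_on S (\<lambda>z. v (cl (snd z)))" for S :: "('a \<times> real) set"
    by (rule continuous_on_compose2[OF contv]) (use cl in \<open>auto simp: cl_def intro!: continuous_intros\<close>)
  let ?T = "t0 + \<tau>"
  obtain B0 where B0: "\<And>x t. t \<in> {0..?T} \<Longrightarrow> G (x, t) \<le> B0 + norm x"
    using growth by blast
  define B where "B = max B0 (G (\<gamma> 0, t0))"
  have B: "G (x, t) \<le> B + norm x" if "t \<in> {0..?T}" for x t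
    using B0[OF that, of x] by (simp add: B_def)
  have key: "G (y t, t) \<le> G (\<gamma> 0, t0) + \<epsilon> + \<epsilon> * (t - t0)" if e: "\<epsilon> > 0" and t: "t0 \<le> t" "t < ?T" for \<epsilon> t
  proof -
    have "continuous_on UNIV (\<lambda>x. G (x, t0))"
      by (rule continuous_on_compose2[OF contG]) (use t0 in \<open>auto intro!: continuous_intros\<close>)
    then have "isCont (\<lambda>x. G (x, t0)) (\<gamma> 0)" by (simp add: continuous_on_eq_continuous_at)
    then obtain \<delta> where \<delta>: "\<delta> > 0" and \<delta>': "\<And>x. norm (x - \<gamma> 0) < \<delta> \<Longrightarrow> \<bar>G (x, t0) - G (\<gamma> 0, t0)\<bar> < \<epsilon>"
      unfolding continuous_at_eps_delta using e by (metis dist_norm real_norm_def)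
    define B' where "B' = B + norm (\<gamma> 0) - G (\<gamma> 0, t0)"
    have B'0: "B' \<ge> 0" using norm_ge_zero[of "\<gamma> 0"] unfolding B_def B'_def by linarith
    \<comment> \<open>Initially the barrier exceeds \<open>G\<close> by continuity within distance \<open>\<delta>\<close> of \<open>\<gamma> 0\<close>, and by this choice of \<open>N\<close>
      farther away.\<close>
    define N where "N = (B' / \<delta> + 1) / \<delta>"
    have N0: "N > 0" using B'0 \<delta> unfolding N_def by (intro divide_pos_pos add_nonneg_pos) auto
    define E where "E t = N * exp (2 * L * (t - t0))" for t
    have E0: "E t > 0" for t using N0 by (simp add: E_def)
    have EN: "E t \<ge> N" if "t0 \<le> t" for t using N0 L that by (simp add: E_def)
    define \<phi> where "\<phi> z = G (\<gamma> 0, t0) + \<epsilon> + \<epsilon> * (snd z - t0) + E (snd z) * ((fst z - y (snd z)) \<bullet> (fst z - y (snd z)))" for z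
    define g where "g z = (2 * E (snd z)) *\<^sub>R (fst z - y (snd z))" for z
    define h where "h z = \<epsilon> + 2 * L * E (snd z) * ((fst z - y (snd z)) \<bullet> (fst z - y (snd z)))
         - 2 * E (snd z) * (v (cl (snd z)) \<bullet> (fst z - y (snd z)))" for z
    have cE: "continuous_on S E" for S unfolding E_def by (intro continuous_intros)
    have ysc: "continuous_on S (\<lambda>z. y (snd z))" "continuous_on S (\<lambda>z. E (snd z))" for S :: "('a \<times> real) set"
      by (rule continuous_on_compose2[OF yc[of UNIV]] continuous_on_compose2[OF cE[of UNIV]]; auto intro!: continuous_intros)+
    have "bounded (y ` {t0..?T})"
      by (intro compact_imp_bounded compact_continuous_image yc) auto
    then obtain Y where Y: "\<And>s. s \<in> {t0..?T} \<Longrightarrow> norm (y s) \<le> Y"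
      unfolding bounded_iff by blast
    have Y0: "Y \<ge> 0" by (rule order_trans[OF norm_ge_zero Y[of t0]]) (use \<tau> in simp)
    define M where "M = (\<bar>B'\<bar> + Y + 1) + 1 / N * 2"
    have M: "M > 0" "N * M \<ge> 2" "M \<ge> \<bar>B'\<bar> + Y + 1"
      using N0 Y0 by (auto simp: M_def algebra_simps intro!: add_pos_nonneg)
    have "G (y t, t) \<le> \<phi> (y t, t)"
    proof (rule comparison_below_barrier[OF contG sub, of \<phi> g h t0 ?T "Y + M"])
      show "C1_with pos_time \<phi> g h"
        unfolding C1_with_def
      proof (intro conjI ballI)
        show "continuous_on pos_time g" unfolding g_def
          by (intro continuous_intros ysc)
        show "continuous_on pos_time h" unfolding h_def
          by (intro continuous_intros ysc clc)
        fix z :: "'a \<times> real"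
        have dE: "((\<lambda>z. E (snd z)) has_derivative (\<lambda>w. 2 * L * E (snd z) * snd w)) (at z)"
          unfolding E_def by (auto intro!: derivative_eq_intros simp: fun_eq_iff)
        have dy: "((\<lambda>z. y (snd z)) has_derivative (\<lambda>w. snd w *\<^sub>R v (cl (snd z)))) (at z)"
          by (rule has_derivative_compose[OF has_derivative_snd[OF has_derivative_ident] y'[unfolded has_vector_derivative_def]])
        have d1: "((\<lambda>z. fst z - y (snd z)) has_derivative (\<lambda>w. fst w - snd w *\<^sub>R v (cl (snd z)))) (at z)"
          by (intro has_derivative_diff dy has_derivative_fst has_derivative_ident)
        show "(\<phi> has_derivative (\<lambda>(y, s). g z \<bullet> y + h z * s)) (at z)"
          unfolding \<phi>_def
          by (rule has_derivative_eq_rhs, (rule derivative_intros dE d1)+)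
            (auto simp: fun_eq_iff g_def h_def algebra_simps inner_commute)
      qed
      show "continuous_on (UNIV \<times> {0..}) \<phi>"
        unfolding \<phi>_def by (intro continuous_intros ysc)
      show "0 \<le> t0" by fact
      show "t0 \<le> t" "t < ?T" by fact+
      have yt0: "y t0 = \<gamma> 0" by (simp add: y_def)
      show "G (x, t0) \<le> \<phi> (x, t0)" for x
      proof (cases "norm (x - \<gamma> 0) < \<delta>")
        case True
        have "E t0 * ((x - \<gamma> 0) \<bullet> (x - \<gamma> 0)) \<ge> 0" using E0[of t0] by simp
        then show ?thesis using \<delta>'[OF True] by (simp add: \<phi>_def yt0)
      next
        case False
        let ?n = "norm (x - \<gamma> 0)"
        have "G (x, t0) - G (\<gamma> 0, t0) \<le> B' + (norm x - norm (\<gamma> 0))"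
          using B[of t0 x] t0 \<tau> by (simp add: B'_def)
        also have "\<dots> \<le> B' + ?n" using norm_triangle_ineq2[of x "\<gamma> 0"] by simp
        also have "\<dots> \<le> B' / \<delta> * ?n + ?n"
          using mult_left_mono[of \<delta> ?n "B' / \<delta>"] False B'0 \<delta> by simp
        also have "\<dots> = N * \<delta> * ?n" using \<delta> by (simp add: N_def field_simps)
        also have "\<dots> \<le> N * ?n * ?n" using False N0 by (intro mult_right_mono mult_left_mono) auto
        also have "\<dots> = E t0 * ((x - \<gamma> 0) \<bullet> (x - \<gamma> 0))"
          by (simp add: E_def dot_square_norm power2_eq_square)
        finally show ?thesis using e by (simp add: \<phi>_def yt0)
      qed
      show "G (x, s) \<le> \<phi> (x, s)" if s: "t0 \<le> s" "s \<le> ?T" and x: "Y + M \<le> norm x" for x s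
      proof -
        let ?n = "norm (x - y s)"
        have yY: "norm (y s) \<le> Y" using Y s by simp
        have nM: "?n \<ge> M" using norm_triangle_ineq2[of x "y s"] yY x by linarith
        have "G (x, s) - G (\<gamma> 0, t0) \<le> B' + norm x - norm (\<gamma> 0)"
          using B[of s x] s t0 by (simp add: B'_def)
        also have "\<dots> \<le> \<bar>B'\<bar> + Y + ?n"
          using norm_triangle_sub[of x "y s"] yY norm_ge_zero[of "\<gamma> 0"] by linarith
        also have "\<dots> \<le> 2 * ?n" using M nM by linarith
        also have "\<dots> \<le> (N * M) * ?n" by (intro mult_right_mono M) auto
        also have "\<dots> \<le> N * ?n * ?n" using nM N0 by (intro mult_right_mono mult_left_mono) auto
        also have "\<dots> \<le> E s * (?n * ?n)" using mult_right_mono[OF EN[OF s(1)], of "?n * ?n"] by simp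
        finally have "G (x, s) - G (\<gamma> 0, t0) \<le> E s * ((x - y s) \<bullet> (x - y s))"
          by (simp add: dot_square_norm power2_eq_square)
        moreover have "\<epsilon> + \<epsilon> * (s - t0) \<ge> 0" using e s by simp
        ultimately show ?thesis by (simp add: \<phi>_def)
      qed
      show "h (x, s) + H x (g (x, s)) > 0" if s: "t0 < s" "s < ?T" for x s
      proof -
        have "cl s = s - t0" "y s = \<gamma> (s - t0)" "s - t0 \<in> {0..\<tau>}"
          using s y\<gamma>[of "s - t0"] by (auto simp: cl_def)
        then have "H x (g (x, s)) \<ge> v (cl s) \<bullet> g (x, s) - L * norm (x - y s) * norm (g (x, s))"
          using ham by simp
        also have "v (cl s) \<bullet> g (x, s) - L * norm (x - y s) * norm (g (x, s))
           = 2 * E s * (v (cl s) \<bullet> (x - y s)) - 2 * L * E s * ((x - y s) \<bullet> (x - y s))"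
          using E0[of s] by (simp add: g_def dot_square_norm power2_eq_square)
        finally show ?thesis using e by (simp add: h_def)
      qed
    qed
    then show ?thesis by (simp add: \<phi>_def)
  qed
  have lim: "G (y t, t) \<le> G (\<gamma> 0, t0)" if t: "t0 \<le> t" "t < ?T" for t
  proof (rule field_le_epsilon)
    fix e :: real assume "e > 0"
    moreover have p: "1 + (t - t0) > 0" using t by simp
    ultimately have "G (y t, t) \<le> G (\<gamma> 0, t0) + e / (1 + (t - t0)) * (1 + (t - t0))"
      using key[of "e / (1 + (t - t0))" t] t by (simp add: distrib_left)
    then show "G (y t, t) \<le> G (\<gamma> 0, t0) + e" using p by simp
  qed
  have "continuous_on {t0..?T} (\<lambda>t. G (y t, t))"
    by (rule continuous_on_compose2[OF contG]) (use t0 in \<open>auto intro!: continuous_intros yc\<close>)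
  then have tl: "((\<lambda>t. G (y t, t)) \<longlongrightarrow> G (y ?T, ?T)) (at ?T within {t0..?T})"
    using \<tau> by (auto simp: continuous_on_def)
  have "G (y ?T, ?T) \<le> G (\<gamma> 0, t0)"
  proof (rule tendsto_upperbound[OF tl])
    show "\<forall>\<^sub>F t in at ?T within {t0..?T}. G (y t, t) \<le> G (\<gamma> 0, t0)"
      unfolding eventually_at_filter by (rule always_eventually) (use lim in force)
    show "at ?T within {t0..?T} \<noteq> bot"
      using \<tau> by (simp add: at_within_Icc_at_left)
  qed
  then show ?thesis using y\<gamma>[of \<tau>] \<tau> by simp
qed

section \<open>Bounds for the flow and the Hamiltonian\<close>

lemma cell_flow_nth [simp]:
  "cell_flow A x $ 1 = - (A * (sin (x$1) * cos (x$2)))"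
  "cell_flow A x $ 2 = A * (cos (x$1) * sin (x$2))"
  by (simp_all add: cell_flow_def)

text \<open>The least factor of \<open>norm q\<close> in the burning term of the Hamiltonian over all directions of \<open>q\<close>,
  in terms of \<open>\<mu> = A d\<close>.\<close>

definition iso_speed :: "real \<Rightarrow> real^2 \<Rightarrow> real"
  where "iso_speed \<mu> x = max (1 - \<mu> * \<bar>cos (x$1) * cos (x$2)\<bar>) 0"

lemma strain_form:
  "q \<bullet> (strain (cell_flow A) x *v q) = A * (cos (x$1) * cos (x$2)) * ((q$2)\<^sup>2 - (q$1)\<^sup>2)"
  by (simp add: strain_cell_flow inner_vec2 matrix_vector_mult_def sum_2 power2_eq_square algebra_simps)

lemma H_plus_ge_isotropic:
  assumes "0 \<le> A" "0 \<le> d"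
  shows "iso_speed (A * d) x * norm q + cell_flow A x \<bullet> q \<le> H_plus d A x q"
proof (cases "q = 0")
  case True then show ?thesis by (simp add: H_plus_def)
next
  case False
  let ?\<Phi> = "cos (x$1) * cos (x$2)" and ?D = "(q$2)\<^sup>2 - (q$1)\<^sup>2"
  have n: "(norm q)\<^sup>2 > 0" using False by simp
  have "\<bar>?\<Phi> * ?D\<bar> \<le> \<bar>?\<Phi>\<bar> * (norm q)\<^sup>2"
    unfolding abs_mult by (intro mult_left_mono) (auto simp: norm_power2_vec2 abs_le_iff)
  then have "- \<bar>?\<Phi>\<bar> * (norm q)\<^sup>2 \<le> ?\<Phi> * ?D"
    unfolding abs_le_iff by (simp only: minus_mult_left[symmetric]) linarith
  then have "- \<bar>?\<Phi>\<bar> \<le> ?\<Phi> * ?D / (norm q)\<^sup>2" using n by (simp add: pos_le_divide_eq)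
  from mult_left_mono[OF this, of "A * d"] have
    "1 - (A * d) * \<bar>?\<Phi>\<bar> \<le> 1 + d * (q \<bullet> (strain (cell_flow A) x *v q)) / (norm q)\<^sup>2"
    using assms by (simp add: strain_form algebra_simps)
  then have "iso_speed (A * d) x \<le> max (1 + d * (q \<bullet> (strain (cell_flow A) x *v q)) / (norm q)\<^sup>2) 0"
    unfolding iso_speed_def by (rule max.mono) simp
  from mult_right_mono[OF this norm_ge_zero[of q]] False show ?thesis
    by (simp add: H_plus_def)
qed

lemma cell_flow_Lipschitz: "norm (cell_flow A x - cell_flow A y) \<le> 4 * \<bar>A\<bar> * norm (x - y)"
proof -
  have "norm (cell_flow A x - cell_flow A y)
      \<le> \<bar>A\<bar> * \<bar>sin (y$1) * cos (y$2) - sin (x$1) * cos (x$2)\<bar> + \<bar>A\<bar> * \<bar>cos (x$1) * sin (x$2) - cos (y$1) * sin (y$2)\<bar>"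
    using norm_le_abs2[of "cell_flow A x - cell_flow A y"]
    by (simp add: algebra_simps flip: abs_mult)
  also have "\<dots> \<le> \<bar>A\<bar> * (2 * norm (x - y)) + \<bar>A\<bar> * (2 * norm (x - y))"
  proof (intro add_mono mult_left_mono abs_ge_zero)
    show "\<bar>sin (y$1) * cos (y$2) - sin (x$1) * cos (x$2)\<bar> \<le> 2 * norm (x - y)"
      using abs_mult_diff_le[of "cos (y$2)" "sin (x$1)" "sin (y$1)" "cos (x$2)"]
        abs_sin_diff_le[of "y$1" "x$1"] abs_cos_diff_le[of "y$2" "x$2"] coordinate_diff_le[of y x]
        norm_minus_commute[of y x]
      by simp
    show "\<bar>cos (x$1) * sin (x$2) - cos (y$1) * sin (y$2)\<bar> \<le> 2 * norm (x - y)"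
      using abs_mult_diff_le[of "sin (x$2)" "cos (y$1)" "cos (x$1)" "sin (y$2)"]
        abs_cos_diff_le[of "x$1" "y$1"] abs_sin_diff_le[of "x$2" "y$2"] coordinate_diff_le[of x y]
      by simp
  qed
  finally show ?thesis by simp
qed

lemma iso_speed_Lipschitz:
  assumes "0 \<le> \<mu>"
  shows "\<bar>iso_speed \<mu> x - iso_speed \<mu> y\<bar> \<le> 2 * \<mu> * norm (x - y)"
proof -
  let ?f = "\<lambda>x::real^2. cos (x$1) * cos (x$2)"
  have "\<bar>iso_speed \<mu> x - iso_speed \<mu> y\<bar> \<le> \<bar>\<mu> * \<bar>?f x\<bar> - \<mu> * \<bar>?f y\<bar>\<bar>"
    unfolding iso_speed_def by linarith
  also have "\<dots> = \<mu> * \<bar>\<bar>?f x\<bar> - \<bar>?f y\<bar>\<bar>" using assms by (simp add: abs_mult flip: right_diff_distrib)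
  also have "\<dots> \<le> \<mu> * (2 * norm (x - y))"
  proof (rule mult_left_mono[OF _ assms])
    have "\<bar>?f x - ?f y\<bar> \<le> 2 * norm (x - y)"
      using abs_mult_diff_le[of "cos (x$2)" "cos (y$1)" "cos (x$1)" "cos (y$2)"]
        abs_cos_diff_le[of "x$1" "y$1"] abs_cos_diff_le[of "x$2" "y$2"] coordinate_diff_le[of x y]
      by simp
    then show "\<bar>\<bar>?f x\<bar> - \<bar>?f y\<bar>\<bar> \<le> 2 * norm (x - y)"
      using abs_triangle_ineq3[of "?f x" "?f y"] by (rule order_trans[rotated])
  qed
  finally show ?thesis by simp
qed

lemma iso_speed_nonneg [simp]: "0 \<le> iso_speed \<mu> x"
  by (simp add: iso_speed_def)

text \<open>Where \<open>\<Phi> = - c\<close> is nonpositive, this bound separates the burning of horizontal gradients from that of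
  vertical ones, which vanishes if \<open>A d c \<ge> 1\<close>.\<close>

lemma H_plus_le_anisotropic:
  fixes x q :: "real^2"
  defines "c \<equiv> - (cos (x$1) * cos (x$2))"
  assumes \<mu>: "0 \<le> A * d" and c: "0 \<le> c"
  shows "H_plus d A x q \<le> \<bar>q$1\<bar> * (1 + A * d * c) + \<bar>q$2\<bar> * max (1 - A * d * c) 0 + cell_flow A x \<bullet> q"
proof (cases "q = 0")
  case True then show ?thesis by (simp add: H_plus_def)
next
  case False
  define n where "n = norm q"
  have n: "n > 0" using False by (simp add: n_def)
  have n2: "n\<^sup>2 = (q$1)\<^sup>2 + (q$2)\<^sup>2" by (simp add: n_def norm_power2_vec2)
  have le: "(q$i)\<^sup>2 / n\<^sup>2 \<le> \<bar>q$i\<bar> / n" for i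
  proof -
    have "\<bar>q$i\<bar> * \<bar>q$i\<bar> \<le> \<bar>q$i\<bar> * n" using component_le_norm_cart[of q i]
      by (intro mult_left_mono) (auto simp: n_def)
    then show ?thesis using n by (simp add: power2_eq_square field_simps)
  qed
  have "1 + d * (q \<bullet> (strain (cell_flow A) x *v q)) / n\<^sup>2
      = ((q$1)\<^sup>2 + (q$2)\<^sup>2) / n\<^sup>2 + A * d * c * ((q$1)\<^sup>2 - (q$2)\<^sup>2) / n\<^sup>2"
    using n by (simp add: strain_form c_def n2[symmetric] algebra_simps)
  also have "\<dots> = (q$1)\<^sup>2 / n\<^sup>2 * (1 + A * d * c) + (q$2)\<^sup>2 / n\<^sup>2 * (1 - A * d * c)"
    by (simp add: field_simps add_divide_distrib diff_divide_distrib)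
  also have "\<dots> \<le> \<bar>q$1\<bar> / n * (1 + A * d * c) + \<bar>q$2\<bar> / n * max (1 - A * d * c) 0"
  proof (rule add_mono)
    show "(q$1)\<^sup>2 / n\<^sup>2 * (1 + A * d * c) \<le> \<bar>q$1\<bar> / n * (1 + A * d * c)"
      using \<mu> c by (intro mult_right_mono le) simp
    have "(q$2)\<^sup>2 / n\<^sup>2 * (1 - A * d * c) \<le> (q$2)\<^sup>2 / n\<^sup>2 * max (1 - A * d * c) 0"
      by (intro mult_left_mono) auto
    also have "\<dots> \<le> \<bar>q$2\<bar> / n * max (1 - A * d * c) 0" by (intro mult_right_mono le) simp
    finally show "(q$2)\<^sup>2 / n\<^sup>2 * (1 - A * d * c) \<le> \<bar>q$2\<bar> / n * max (1 - A * d * c) 0" .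
  qed
  finally have "max (1 + d * (q \<bullet> (strain (cell_flow A) x *v q)) / n\<^sup>2) 0
      \<le> \<bar>q$1\<bar> / n * (1 + A * d * c) + \<bar>q$2\<bar> / n * max (1 - A * d * c) 0"
    using n \<mu> c by simp
  from mult_right_mono[OF this, of n] n
  have "max (1 + d * (q \<bullet> (strain (cell_flow A) x *v q)) / n\<^sup>2) 0 * n
      \<le> (\<bar>q$1\<bar> / n * (1 + A * d * c) + \<bar>q$2\<bar> / n * max (1 - A * d * c) 0) * n" by simp
  also have "\<dots> = \<bar>q$1\<bar> * (1 + A * d * c) + \<bar>q$2\<bar> * max (1 - A * d * c) 0"
    using n by (simp add: distrib_right)
  finally have "max (1 + d * (q \<bullet> (strain (cell_flow A) x *v q)) / n\<^sup>2) 0 * n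
      \<le> \<bar>q$1\<bar> * (1 + A * d * c) + \<bar>q$2\<bar> * max (1 - A * d * c) 0" .
  then show ?thesis using False by (simp add: H_plus_def n_def)
qed

text \<open>The last bound expresses the hypothesis \<open>A d > sqrt (1 + 4 d\<^sup>2)\<close> in terms of the dynamics: at the
  ends of the segment the drift \<open>A sin r\<close> beats the horizontal burning speed \<open>2\<close>.\<close>

lemma r_angle_bounds:
  assumes d: "0 < d" and \<mu>: "sqrt (1 + 4 * d\<^sup>2) < A * d"
  shows "1 < A * d" "0 < r_angle (A * d)" "r_angle (A * d) < pi / 2"
    "A * d * cos (r_angle (A * d)) = 1" "2 < A * sin (r_angle (A * d))"
proof -
  let ?\<mu> = "A * d" and ?r = "r_angle (A * d)"
  have "1 \<le> sqrt (1 + 4 * d\<^sup>2)" by simp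
  with \<mu> show 1: "1 < ?\<mu>" by linarith
  have i: "0 < 1 / ?\<mu>" "1 / ?\<mu> < 1" using 1 by simp_all
  show r0: "0 < ?r" using arccos_less_arccos[of "1 / ?\<mu>" 1] i by (simp add: r_angle_def)
  show r1: "?r < pi / 2" using arccos_less_arccos[of 0 "1 / ?\<mu>"] i by (simp add: r_angle_def)
  have cr: "cos ?r = 1 / ?\<mu>" using i unfolding r_angle_def by (intro cos_arccos) linarith+
  moreover have "?\<mu> \<noteq> 0" using 1 by linarith
  ultimately show \<mu>cr: "?\<mu> * cos ?r = 1" by (simp del: mult_eq_0_iff)
  have A0: "0 < A" using 1 d zero_less_mult_pos2[of A d] by simp
  have "1 + 4 * d\<^sup>2 < ?\<mu>\<^sup>2"
    using power_strict_mono[OF \<mu>, of 2] by simp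
  moreover have "(A * sin ?r)\<^sup>2 * d\<^sup>2 = ?\<mu>\<^sup>2 - (?\<mu> * cos ?r)\<^sup>2"
    by (simp add: power_mult_distrib sin_squared_eq algebra_simps)
  ultimately have "2\<^sup>2 * d\<^sup>2 < (A * sin ?r)\<^sup>2 * d\<^sup>2" unfolding \<mu>cr by simp
  then have "2\<^sup>2 < (A * sin ?r)\<^sup>2" using d by simp
  moreover have "0 \<le> A * sin ?r" using A0 r0 r1 by (intro mult_nonneg_nonneg sin_ge_zero) auto
  ultimately show "2 < A * sin ?r" by (rule power2_less_imp_less)
qed

section \<open>Controlled paths and the symmetries of the flow\<close>

text \<open>Curves driven by the flow and by a control of size at most \<open>iso_speed\<close>; \<open>v\<close> is the velocity.\<close>

definition admissible_path :: "real \<Rightarrow> real \<Rightarrow> real \<Rightarrow> (real \<Rightarrow> real^2) \<Rightarrow> (real \<Rightarrow> real^2) \<Rightarrow> bool"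
  where "admissible_path A \<mu> \<tau> \<gamma> v \<longleftrightarrow> 0 \<le> \<tau> \<and> continuous_on {0..\<tau>} v \<and>
    (\<forall>s\<in>{0..\<tau>}. (\<gamma> has_vector_derivative v s) (at s within {0..\<tau>}) \<and>
       norm (v s - cell_flow A (\<gamma> s)) \<le> iso_speed \<mu> (\<gamma> s))"

text \<open>\<open>reach A \<mu> \<tau> x y\<close>: finitely many controlled paths in succession lead from \<open>x\<close> to \<open>y\<close> in total time
  \<open>\<tau>\<close>. The velocity may jump from one path to the next.\<close>

inductive reach :: "real \<Rightarrow> real \<Rightarrow> real \<Rightarrow> real^2 \<Rightarrow> real^2 \<Rightarrow> bool" for A \<mu> :: real
  where
    path: "admissible_path A \<mu> \<tau> \<gamma> v \<Longrightarrow> x = \<gamma> 0 \<Longrightarrow> y = \<gamma> \<tau> \<Longrightarrow> reach A \<mu> \<tau> x y"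
  | trans: "reach A \<mu> \<tau> x y \<Longrightarrow> reach A \<mu> \<sigma> y z \<Longrightarrow> reach A \<mu> (\<tau> + \<sigma>) x z"

lemma reach_time_nonneg: "reach A \<mu> \<tau> x y \<Longrightarrow> 0 \<le> \<tau>"
  by (induction rule: reach.induct) (auto simp: admissible_path_def)

lemma reach_symmetry:
  assumes "reach A \<mu> \<tau> x y"
    and L: "bounded_linear L" "\<And>x. norm (L x) = norm x"
    and V: "\<And>x. cell_flow A (L x + b) = L (cell_flow A x)"
    and a: "\<And>x. iso_speed \<mu> (L x + b) = iso_speed \<mu> x"
  shows "reach A \<mu> \<tau> (L x + b) (L y + b)"
  using assms(1)
proof induction
  case (path \<tau> \<gamma> v x y)
  have "admissible_path A \<mu> \<tau> (\<lambda>s. L (\<gamma> s) + b) (\<lambda>s. L (v s))"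
    unfolding admissible_path_def
  proof (intro conjI ballI)
    show "0 \<le> \<tau>" using path by (simp add: admissible_path_def)
    show "continuous_on {0..\<tau>} (\<lambda>s. L (v s))"
      using path by (auto simp: admissible_path_def intro!: bounded_linear.continuous_on[OF L(1)])
    fix s assume s: "s \<in> {0..\<tau>}"
    have "((\<lambda>s. L (\<gamma> s)) has_vector_derivative L (v s)) (at s within {0..\<tau>})"
      using path s by (intro bounded_linear.has_vector_derivative[OF L(1)]) (auto simp: admissible_path_def)
    then show "((\<lambda>s. L (\<gamma> s) + b) has_vector_derivative L (v s)) (at s within {0..\<tau>})"
      by (auto intro!: derivative_eq_intros)
    have "norm (L (v s) - L (cell_flow A (\<gamma> s))) = norm (v s - cell_flow A (\<gamma> s))"
      using L by (metis bounded_linear.linear linear_diff)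
    then show "norm (L (v s) - cell_flow A (L (\<gamma> s) + b)) \<le> iso_speed \<mu> (L (\<gamma> s) + b)"
      using path s by (simp add: V a admissible_path_def)
  qed
  then show ?case by (rule reach.path) (use path in auto)
next
  case trans then show ?case by (blast intro: reach.trans)
qed

text \<open>An isometry that reverses the flow maps controlled paths to controlled paths traversed backwards.\<close>

lemma reach_reversing_symmetry:
  assumes "reach A \<mu> \<tau> x y"
    and L: "bounded_linear L" "\<And>x. norm (L x) = norm x"
    and V: "\<And>x. cell_flow A (L x) = - L (cell_flow A x)"
    and a: "\<And>x. iso_speed \<mu> (L x) = iso_speed \<mu> x"
  shows "reach A \<mu> \<tau> (L y) (L x)"
  using assms(1)
proof induction
  case (path \<tau> \<gamma> v x y)
  have "admissible_path A \<mu> \<tau> (\<lambda>s. L (\<gamma> (\<tau> - s))) (\<lambda>s. - L (v (\<tau> - s)))"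
    unfolding admissible_path_def
  proof (intro conjI ballI)
    show "0 \<le> \<tau>" using path by (simp add: admissible_path_def)
    have "continuous_on {0..\<tau>} v" using path by (simp add: admissible_path_def)
    then have "continuous_on {0..\<tau>} (\<lambda>s. v (\<tau> - s))"
      by (rule continuous_on_compose2) (auto intro!: continuous_intros)
    then show "continuous_on {0..\<tau>} (\<lambda>s. - L (v (\<tau> - s)))"
      by (intro continuous_on_minus bounded_linear.continuous_on[OF L(1)])
    fix s assume s: "s \<in> {0..\<tau>}"
    then have s': "\<tau> - s \<in> {0..\<tau>}" by auto
    have im: "(\<lambda>s. \<tau> - s) ` {0..\<tau>} = {0..\<tau>}" by simp
    have 1: "((\<lambda>s. \<tau> - s) has_vector_derivative - 1) (at s within {0..\<tau>})"
      by (auto intro!: derivative_eq_intros)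
    have 2: "(\<gamma> has_vector_derivative v (\<tau> - s)) (at (\<tau> - s) within (\<lambda>s. \<tau> - s) ` {0..\<tau>})"
      unfolding im using path s' by (simp add: admissible_path_def)
    have "((\<lambda>s. \<gamma> (\<tau> - s)) has_vector_derivative - v (\<tau> - s)) (at s within {0..\<tau>})"
      using vector_diff_chain_within[OF 1 2] by (simp add: o_def)
    from bounded_linear.has_vector_derivative[OF L(1) this]
    show "((\<lambda>s. L (\<gamma> (\<tau> - s))) has_vector_derivative - L (v (\<tau> - s))) (at s within {0..\<tau>})"
      using L by (simp add: bounded_linear.linear linear_neg)
    have "norm (- L (v (\<tau> - s)) + L (cell_flow A (\<gamma> (\<tau> - s)))) = norm (v (\<tau> - s) - cell_flow A (\<gamma> (\<tau> - s)))"
      using L by (metis bounded_linear.linear linear_diff norm_minus_commute uminus_add_conv_diff)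
    then show "norm (- L (v (\<tau> - s)) - cell_flow A (L (\<gamma> (\<tau> - s)))) \<le> iso_speed \<mu> (L (\<gamma> (\<tau> - s)))"
      using path s' by (simp add: V a admissible_path_def)
  qed
  then show ?case by (rule reach.path) (use path in auto)
next
  case trans then show ?case by (metis add.commute reach.trans)
qed

lemma bounded_linear_vec2:
  "bounded_linear (\<lambda>x::real^2. vector [a * x$1 + b * x$2, c * x$1 + e * x$2] :: real^2)"
  by (intro linear_conv_bounded_linear[THEN iffD1] linearI) (auto simp: vec2_eq algebra_simps)

text \<open>The flow is equivariant under the reflections of the two coordinates and invariant under the translations
  by \<open>(m \<pi>, n \<pi>)\<close> with \<open>m + n\<close> even.\<close>

lemma reach_symmetry_coord:
  fixes \<epsilon>1 \<epsilon>2 :: real and m n :: int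
  assumes "reach A \<mu> \<tau> (vector [x1, x2]) (vector [y1, y2])"
    and e: "\<bar>\<epsilon>1\<bar> = 1" "\<bar>\<epsilon>2\<bar> = 1" "even (m + n)"
  shows "reach A \<mu> \<tau> (vector [\<epsilon>1 * x1 + of_int m * pi, \<epsilon>2 * x2 + of_int n * pi])
                       (vector [\<epsilon>1 * y1 + of_int m * pi, \<epsilon>2 * y2 + of_int n * pi])"
proof -
  define L :: "real^2 \<Rightarrow> real^2" where "L x = vector [\<epsilon>1 * x$1, \<epsilon>2 * x$2]" for x
  define b :: "real^2" where "b = vector [of_int m * pi, of_int n * pi]"
  have e': "\<epsilon>1 = 1 \<or> \<epsilon>1 = -1" "\<epsilon>2 = 1 \<or> \<epsilon>2 = -1" using e by linarith+
  have par: "even m \<and> even n \<or> odd m \<and> odd n" using e by auto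
  have sc: "sin (x + of_int k * pi) = (if even k then sin x else - sin x)"
      "cos (x + of_int k * pi) = (if even k then cos x else - cos x)" for x and k :: int
    by (auto simp: sin_add cos_add mult.commute[of _ pi])
  have blL: "bounded_linear L"
    using bounded_linear_vec2[of \<epsilon>1 0 0 \<epsilon>2] by (simp add: L_def[abs_def])
  have "reach A \<mu> \<tau> (L (vector [x1, x2]) + b) (L (vector [y1, y2]) + b)"
  proof (rule reach_symmetry[OF assms(1) blL])
    show "norm (L x) = norm x" for x
      using e' by (auto simp: L_def norm_eq_sqrt_inner inner_vec2)
    show "cell_flow A (L x + b) = L (cell_flow A x)" for x
      using e' par by (auto simp: vec2_eq L_def b_def sc)
    show "iso_speed \<mu> (L x + b) = iso_speed \<mu> x" for x
      using e' par by (auto simp: iso_speed_def L_def b_def sc)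
  qed
  moreover have "L (vector [u, w]) + b = vector [\<epsilon>1 * u + of_int m * pi, \<epsilon>2 * w + of_int n * pi]" for u w
    by (simp add: vec2_eq L_def b_def)
  ultimately show ?thesis by simp
qed

lemma reach_swap:
  assumes "reach A \<mu> \<tau> (vector [x1, x2]) (vector [y1, y2])"
  shows "reach A \<mu> \<tau> (vector [x2, x1 + pi]) (vector [y2, y1 + pi])"
proof -
  define L :: "real^2 \<Rightarrow> real^2" where "L x = vector [x$2, x$1]" for x
  define b :: "real^2" where "b = vector [0, pi]"
  have blL: "bounded_linear L"
    using bounded_linear_vec2[of 0 1 1 0] by (simp add: L_def[abs_def])
  have "reach A \<mu> \<tau> (L (vector [x1, x2]) + b) (L (vector [y1, y2]) + b)"
  proof (rule reach_symmetry[OF assms(1) blL])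
    show "norm (L x) = norm x" for x
      by (auto simp: L_def norm_eq_sqrt_inner inner_vec2 add.commute)
    show "cell_flow A (L x + b) = L (cell_flow A x)" for x
      by (auto simp: vec2_eq L_def b_def mult.commute)
    show "iso_speed \<mu> (L x + b) = iso_speed \<mu> x" for x
      by (auto simp: iso_speed_def L_def b_def mult.commute)
  qed
  moreover have "L (vector [u, w]) + b = vector [w, u + pi]" for u w
    by (simp add: vec2_eq L_def b_def)
  ultimately show ?thesis by simp
qed

lemma reach_antidiagonal_mirror:
  assumes "reach A \<mu> \<tau> (vector [x1, x2]) (vector [y1, y2])"
  shows "reach A \<mu> \<tau> (vector [- y2, - y1]) (vector [- x2, - x1])"
proof -
  define L :: "real^2 \<Rightarrow> real^2" where "L x = vector [- x$2, - x$1]" for x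
  have blL: "bounded_linear L"
    using bounded_linear_vec2[of 0 "-1" "-1" 0] by (simp add: L_def[abs_def])
  have "reach A \<mu> \<tau> (L (vector [y1, y2])) (L (vector [x1, x2]))"
  proof (rule reach_reversing_symmetry[OF assms(1) blL])
    show "norm (L x) = norm x" for x
      by (auto simp: L_def norm_eq_sqrt_inner inner_vec2 add.commute)
    show "cell_flow A (L x) = - L (cell_flow A x)" for x
      by (auto simp: vec2_eq L_def mult.commute)
    show "iso_speed \<mu> (L x) = iso_speed \<mu> x" for x
      by (auto simp: iso_speed_def L_def mult.commute)
  qed
  then show ?thesis by (simp add: L_def)
qed

section \<open>From one edge midpoint to the next\<close>

text \<open>The curve \<open>- sin \<theta> sin x\<^sub>2 = k \<theta>\<close> is traversed with \<open>x\<^sub>1 = \<theta>\<close> moving exactly as the flow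
  prescribes. The vertical velocity then deviates from that of the flow by exactly \<open>A k'\<close>; in particular no control is
  needed on a stream line, where \<open>k\<close> is constant. The time bound comes from
  \<open>\<theta>' \<ge> - A \<theta> / 4\<close>.\<close>

lemma reach_along_stream_graph:
  fixes A \<mu> \<theta>0 \<theta>1 k0 k1 :: real
  defines "k \<equiv> \<lambda>\<theta>. k0 + k1 * (\<theta> - \<theta>0)"
  assumes A: "0 < A" and \<mu>: "0 \<le> \<mu>" and \<theta>: "- pi / 2 \<le> \<theta>0" "\<theta>0 < \<theta>1" "\<theta>1 < 0"
    and k: "\<And>\<theta>. \<theta> \<in> {\<theta>0..\<theta>1} \<Longrightarrow> 0 \<le> k \<theta> \<and> k \<theta> \<le> sin (- \<theta>) / 2"
    and slope: "\<And>\<theta>. \<theta> \<in> {\<theta>0..\<theta>1} \<Longrightarrow> k1 = 0 \<or> A * \<bar>k1\<bar> \<le> 1 - \<mu> * cos \<theta>"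
  shows "\<exists>\<tau>\<le>4 / A * (ln (- \<theta>0) - ln (- \<theta>1)).
    reach A \<mu> \<tau> (vector [\<theta>0, arcsin (k \<theta>0 / sin (- \<theta>0))]) (vector [\<theta>1, arcsin (k \<theta>1 / sin (- \<theta>1))])"
proof -
  define u where "u \<theta> = k \<theta> / sin (- \<theta>)" for \<theta>
  define f where "f \<theta> = arcsin (u \<theta>)" for \<theta>
  define l where "l \<theta> = A * sin (- \<theta>) * cos (f \<theta>)" for \<theta>
  have sin_ge: "- \<theta> / 2 \<le> sin (- \<theta>)" if "\<theta> \<in> {\<theta>0..\<theta>1}" for \<theta>
    using half_le_sin[of "- \<theta>"] that \<theta> by auto
  have sinp: "sin (- \<theta>) > 0" if "\<theta> \<in> {\<theta>0..\<theta>1}" for \<theta> using sin_ge[OF that] that \<theta> by simp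
  have u: "0 \<le> u \<theta>" "u \<theta> \<le> 1/2" if "\<theta> \<in> {\<theta>0..\<theta>1}" for \<theta>
    using k[OF that] sinp[OF that] by (simp_all add: u_def pos_divide_le_eq del: sin_minus)
  have sinf: "sin (f \<theta>) = u \<theta>" if "\<theta> \<in> {\<theta>0..\<theta>1}" for \<theta>
    using u[OF that] by (simp add: f_def)
  have cosf: "cos (f \<theta>) = sqrt (1 - (u \<theta>)\<^sup>2)" if "\<theta> \<in> {\<theta>0..\<theta>1}" for \<theta>
    using u[OF that] by (simp add: f_def cos_arcsin)
  have cosf_ge: "1/2 \<le> cos (f \<theta>)" if "\<theta> \<in> {\<theta>0..\<theta>1}" for \<theta>
  proof -
    have "(u \<theta>)\<^sup>2 \<le> (1/2)\<^sup>2" using u[OF that] by (intro power_mono)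
    then show ?thesis unfolding cosf[OF that] by (intro real_le_rsqrt) (simp add: power2_eq_square)
  qed
  have l_ge: "A * (- \<theta>) / 4 \<le> l \<theta>" if "\<theta> \<in> {\<theta>0..\<theta>1}" for \<theta>
  proof -
    have "A * (- \<theta> / 2) * (1/2) \<le> A * sin (- \<theta>) * cos (f \<theta>)"
      using A sin_ge[OF that] sinp[OF that] cosf_ge[OF that] that \<theta>
      by (intro mult_mono mult_left_mono mult_nonneg_nonneg) (auto simp del: sin_minus)
    then show ?thesis by (simp add: l_def)
  qed
  have l0: "0 < l \<theta>" if "\<theta> \<in> {\<theta>0..\<theta>1}" for \<theta>
    using l_ge[OF that] A that \<theta> mult_pos_pos[of A "- \<theta>"] by auto
  have u': "(u has_real_derivative (k1 * sin (- \<theta>) + k \<theta> * cos \<theta>) / (sin (- \<theta>))\<^sup>2) (at \<theta>)"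
    if "\<theta> \<in> {\<theta>0..\<theta>1}" for \<theta>
    unfolding u_def k_def using sinp[OF that]
    by (auto intro!: derivative_eq_intros simp: power2_eq_square field_simps)
  have f': "(f has_real_derivative (k1 * sin (- \<theta>) + k \<theta> * cos \<theta>) / (sin (- \<theta>))\<^sup>2 / cos (f \<theta>)) (at \<theta>)"
    if "\<theta> \<in> {\<theta>0..\<theta>1}" for \<theta>
  proof -
    have "(arcsin has_real_derivative inverse (sqrt (1 - (u \<theta>)\<^sup>2))) (at (u \<theta>))"
      using u[OF that] by (intro DERIV_arcsin) auto
    from DERIV_chain'[OF u'[OF that] this] show ?thesis
      by (simp add: f_def[abs_def] cosf[OF that, unfolded f_def] field_simps)
  qed
  have contu: "continuous_on {\<theta>0..\<theta>1} u" and contf: "continuous_on {\<theta>0..\<theta>1} f"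
    using u' f' by (meson DERIV_isCont continuous_at_imp_continuous_on)+
  have contl: "continuous_on {\<theta>0..\<theta>1} l" unfolding l_def by (intro continuous_intros contf)
  obtain \<tau> g where g: "0 \<le> \<tau>" "g 0 = \<theta>0" "g \<tau> = \<theta>1" "\<And>s. s \<in> {0..\<tau>} \<Longrightarrow> g s \<in> {\<theta>0..\<theta>1}"
    "\<And>s. s \<in> {0..\<tau>} \<Longrightarrow> (g has_real_derivative l (g s)) (at s within {0..\<tau>})"
    and \<tau>: "\<And>B B'. (\<And>\<theta>. \<theta> \<in> {\<theta>0..\<theta>1} \<Longrightarrow> (B has_real_derivative B' \<theta>) (at \<theta>) \<and> 1 / l \<theta> \<le> B' \<theta>)
        \<Longrightarrow> \<tau> \<le> B \<theta>1 - B \<theta>0"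
    using autonomous_ode_solution[OF \<theta>(2) contl l0] by blast
  have "\<tau> \<le> (\<lambda>x. - (4 / A) * ln (- x)) \<theta>1 - (\<lambda>x. - (4 / A) * ln (- x)) \<theta>0"
  proof (rule \<tau>[where B' = "\<lambda>x. 4 / (A * (- x))"])
    fix x assume x: "x \<in> {\<theta>0..\<theta>1}"
    then have x0: "x < 0" using \<theta> by simp
    have "((\<lambda>x. - (4 / A) * ln (- x)) has_real_derivative 4 / (A * (- x))) (at x)"
      using x0 A by (auto intro!: derivative_eq_intros simp: field_simps)
    moreover have "1 / l x \<le> 1 / (A * (- x) / 4)"
      using l_ge[OF x] x0 A mult_pos_pos[of A "- x"] by (intro divide_left_mono mult_pos_pos l0 x) auto
    ultimately show "((\<lambda>x. - (4 / A) * ln (- x)) has_real_derivative 4 / (A * (- x))) (at x) \<and> 1 / l x \<le> 4 / (A * (- x))"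
      by simp
  qed
  then have \<tau>_le: "\<tau> \<le> 4 / A * (ln (- \<theta>0) - ln (- \<theta>1))" by (simp add: algebra_simps)
  define \<gamma> where "\<gamma> s = (vector [g s, f (g s)] :: real^2)" for s
  define v where "v s = (vector [l (g s), A * k1 + A * cos (g s) * u (g s)] :: real^2)" for s
  have contg: "continuous_on {0..\<tau>} g"
    using g(5) by (meson DERIV_continuous continuous_on_eq_continuous_within)
  have im: "g ` {0..\<tau>} \<subseteq> {\<theta>0..\<theta>1}" using g(4) by blast
  have "admissible_path A \<mu> \<tau> \<gamma> v"
    unfolding admissible_path_def
  proof (intro conjI ballI)
    show "0 \<le> \<tau>" by fact
    have "continuous_on {0..\<tau>} (\<lambda>s. l (g s))" "continuous_on {0..\<tau>} (\<lambda>s. u (g s))"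
      by (rule continuous_on_compose2[OF contl contg im] continuous_on_compose2[OF contu contg im])+
    then show "continuous_on {0..\<tau>} v"
      unfolding v_def vector_2_eq_axes by (auto intro!: continuous_intros contg)
    fix s assume s: "s \<in> {0..\<tau>}"
    let ?x = "g s"
    have x: "?x \<in> {\<theta>0..\<theta>1}" using g(4) s by blast
    have "((\<lambda>s. f (g s)) has_real_derivative
        (k1 * sin (- ?x) + k ?x * cos ?x) / (sin (- ?x))\<^sup>2 / cos (f ?x) * l ?x) (at s within {0..\<tau>})"
      by (rule DERIV_chain'[OF g(5)[OF s] f'[OF x]])
    also have "(k1 * sin (- ?x) + k ?x * cos ?x) / (sin (- ?x))\<^sup>2 / cos (f ?x) * l ?x
        = A * k1 + A * cos ?x * u ?x"
      using sinp[OF x] cosf_ge[OF x] by (simp add: l_def u_def power2_eq_square field_simps)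
    finally show "(\<gamma> has_vector_derivative v s) (at s within {0..\<tau>})"
      unfolding \<gamma>_def v_def by (intro has_vector_derivative_vec2 g(5) s)
    have "v s - cell_flow A (\<gamma> s) = vector [0, A * k1]"
      by (simp add: vec2_eq v_def \<gamma>_def l_def sinf[OF x])
    then have "norm (v s - cell_flow A (\<gamma> s)) = A * \<bar>k1\<bar>"
      using A by (simp add: norm_eq_sqrt_inner inner_vec2 abs_mult)
    also have "\<dots> \<le> iso_speed \<mu> (\<gamma> s)"
    proof (cases "k1 = 0")
      case False
      have "cos ?x \<ge> 0" using x \<theta> by (intro cos_ge_zero) auto
      then have "\<bar>cos ?x * cos (f ?x)\<bar> \<le> cos ?x"
        using mult_left_mono[OF abs_cos_le_one[of "f ?x"], of "cos ?x"] by (simp add: abs_mult)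
      then have "1 - \<mu> * cos ?x \<le> iso_speed \<mu> (\<gamma> s)"
        using mult_left_mono[OF _ \<mu>] by (force simp: iso_speed_def \<gamma>_def le_max_iff_disj)
      then show ?thesis using slope[OF x] False by simp
    qed simp
    finally show "norm (v s - cell_flow A (\<gamma> s)) \<le> iso_speed \<mu> (\<gamma> s)" .
  qed
  then have "reach A \<mu> \<tau> (vector [\<theta>0, f \<theta>0]) (vector [\<theta>1, f \<theta>1])"
    by (rule reach.path) (simp_all add: \<gamma>_def g)
  then show ?thesis using \<tau>_le unfolding f_def u_def by blast
qed

text \<open>From the midpoint \<open>(-\<pi>/2, 0)\<close> of an edge around the corner \<open>(0, 0)\<close> to the midpoint
  \<open>(0, \<pi>/2)\<close> of the next one. Until \<open>x\<^sub>1 = -\<pi>/3\<close> a control of size \<open>1/4\<close> raises the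
  stream function from \<open>0\<close> to \<open>\<kappa>\<close>; then the stream line is followed up to the antidiagonal, which it meets
  at \<open>(-\<beta>, \<beta>)\<close> with \<open>sin\<^sup>2 \<beta> = \<kappa>\<close>. The rest is the mirror image in the antidiagonal with time reversed.\<close>

lemma reach_quarter_turn:
  assumes A: "19 \<le> A" and \<mu>: "0 \<le> \<mu>" "\<mu> \<le> 3/2"
  obtains \<tau> where "\<tau> \<le> 16 * ln A / A" "reach A \<mu> \<tau> (vector [- pi/2, 0]) (vector [0, pi/2])"
proof -
  define \<kappa> where "\<kappa> = pi / (24 * A)"
  define \<beta> where "\<beta> = arcsin (sqrt \<kappa>)"
  have \<kappa>1: "(1 / A)\<^sup>2 \<le> \<kappa>" using A pi_gt3 mult_mono[of 19 A 3 pi]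
    by (simp add: \<kappa>_def power2_eq_square field_simps)
  have \<kappa>2: "\<kappa> \<le> 1/100" using A pi_less_4 by (simp add: \<kappa>_def field_simps)
  have \<kappa>0: "\<kappa> > 0" using A by (simp add: \<kappa>_def)
  have sq: "1 / A \<le> sqrt \<kappa>" "sqrt \<kappa> \<le> 1/10" "sqrt \<kappa> > 0"
    using real_le_rsqrt[OF \<kappa>1] real_le_lsqrt[of "1/10" \<kappa>] \<kappa>2 \<kappa>0 by (simp_all add: power2_eq_square)
  have sin\<beta>: "sin \<beta> = sqrt \<kappa>" unfolding \<beta>_def by (rule sin_arcsin) (use sq in linarith)+
  have \<beta>0: "\<beta> > 0" using sq \<kappa>2 arcsin_less_arcsin[of 0 "sqrt \<kappa>"] by (simp add: \<beta>_def)
  have s3: "8/5 \<le> sqrt (3::real)" by (rule real_le_rsqrt) (simp add: power2_eq_square)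
  have "arcsin (sqrt \<kappa>) < arcsin (sin (pi/3))"
    unfolding sin_60 using sq s3 sin_le_one[of "pi/3", unfolded sin_60]
    by (intro arcsin_less_arcsin) linarith+
  moreover have "arcsin (sin (pi/3)) = pi/3"
    by (rule arcsin_sin) (use pi_gt_zero in linarith)+
  ultimately have \<beta>1: "\<beta> < pi/3" by (simp add: \<beta>_def)
  have \<beta>ge: "1 / A \<le> \<beta>" using sin_x_le_x[of \<beta>] \<beta>0 sq sin\<beta> by linarith
  let ?m = "vector [- (pi/3), arcsin (\<kappa> / sin (pi/3))] :: real^2"
  have stage1: "\<exists>\<tau>\<le>4 / A * (ln (- (- pi/2)) - ln (- (- (pi/3)))). reach A \<mu> \<tau>
     (vector [- pi/2, arcsin ((0 + 1 / (4 * A) * (- pi/2 - - pi/2)) / sin (- (- pi/2)))])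
     (vector [- (pi/3), arcsin ((0 + 1 / (4 * A) * (- (pi/3) - - pi/2)) / sin (- (- (pi/3))))])"
  proof (rule reach_along_stream_graph)
    fix \<theta> assume \<theta>: "\<theta> \<in> {- pi/2..- (pi/3)}"
    have "cos \<theta> = cos (- \<theta>)" by simp
    also have "\<dots> \<le> cos (pi/3)" using \<theta> by (intro cos_monotone_0_pi_le) auto
    finally have "cos \<theta> \<le> 1/2" by (simp add: cos_60)
    moreover have "cos \<theta> \<ge> 0" using \<theta> by (intro cos_ge_zero) auto
    ultimately have "\<mu> * cos \<theta> \<le> 3/2 * (1/2)" using \<mu> by (intro mult_mono) auto
    then show "1 / (4 * A) = 0 \<or> A * \<bar>1 / (4 * A)\<bar> \<le> 1 - \<mu> * cos \<theta>" using A by simp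
    have "sin (pi/3) \<le> sin (- \<theta>)" using \<theta> by (intro sin_monotone_2pi_le) auto
    then have "2/5 \<le> sin (- \<theta>) / 2" using s3 by (simp add: sin_60)
    moreover have "1 / (4 * A) * (\<theta> - - pi/2) \<le> 1 / (4 * A) * (pi / 6)"
      using \<theta> A by (intro mult_left_mono) auto
    moreover have "1 / (4 * A) * (pi / 6) = \<kappa>" by (simp add: \<kappa>_def)
    moreover have "0 \<le> 1 / (4 * A) * (\<theta> - - pi/2)" using \<theta> A by (intro mult_nonneg_nonneg) auto
    ultimately show "0 \<le> 0 + 1 / (4 * A) * (\<theta> - - pi/2) \<and> 0 + 1 / (4 * A) * (\<theta> - - pi/2) \<le> sin (- \<theta>) / 2"
      using \<kappa>2 by linarith
  qed (use A \<mu> in auto)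
  have "1 / (4 * A) * (- (pi/3) - - pi/2) = \<kappa>" by (simp add: \<kappa>_def)
  then obtain \<tau>1 where \<tau>1: "\<tau>1 \<le> 4 / A * (ln (pi/2) - ln (pi/3))" "reach A \<mu> \<tau>1 (vector [- pi/2, 0]) ?m"
    using stage1 by auto
  have stage2: "\<exists>\<tau>\<le>4 / A * (ln (- (- (pi/3))) - ln (- (- \<beta>))). reach A \<mu> \<tau>
     (vector [- (pi/3), arcsin ((\<kappa> + 0 * (- (pi/3) - - (pi/3))) / sin (- (- (pi/3))))])
     (vector [- \<beta>, arcsin ((\<kappa> + 0 * (- \<beta> - - (pi/3))) / sin (- (- \<beta>)))])"
  proof (rule reach_along_stream_graph)
    fix \<theta> assume \<theta>: "\<theta> \<in> {- (pi/3)..- \<beta>}"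
    have "sqrt \<kappa> \<le> sin (- \<theta>)" unfolding sin\<beta>[symmetric]
      using \<theta> \<beta>0 by (intro sin_monotone_2pi_le) auto
    moreover have "\<kappa> \<le> sqrt \<kappa> / 2"
    proof -
      have "\<kappa> = sqrt \<kappa> * sqrt \<kappa>" using \<kappa>0 by simp
      also have "\<dots> \<le> sqrt \<kappa> * (1/2)" using sq by (intro mult_left_mono) auto
      finally show ?thesis by simp
    qed
    ultimately show "0 \<le> \<kappa> + 0 * (\<theta> - - (pi/3)) \<and> \<kappa> + 0 * (\<theta> - - (pi/3)) \<le> sin (- \<theta>) / 2"
      using \<kappa>0 by simp
  qed (use A \<mu> \<beta>0 \<beta>1 in auto)
  have "\<kappa> / sin \<beta> = sqrt \<kappa>" using \<kappa>0 sq by (simp add: sin\<beta> real_div_sqrt)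
  then obtain \<tau>2 where \<tau>2: "\<tau>2 \<le> 4 / A * (ln (pi/3) - ln \<beta>)" "reach A \<mu> \<tau>2 ?m (vector [- \<beta>, \<beta>])"
    using stage2 by (auto simp: \<beta>_def)
  let ?\<tau> = "\<tau>1 + \<tau>2"
  have half: "reach A \<mu> ?\<tau> (vector [- pi/2, 0]) (vector [- \<beta>, \<beta>])"
    using \<tau>1(2) \<tau>2(2) by (rule reach.trans)
  from reach_antidiagonal_mirror[OF half]
  have "reach A \<mu> ?\<tau> (vector [- \<beta>, \<beta>]) (vector [0, pi/2])" by simp
  with half have full: "reach A \<mu> (?\<tau> + ?\<tau>) (vector [- pi/2, 0]) (vector [0, pi/2])"
    by (rule reach.trans)
  have "pi / 2 \<le> A" using A pi_less_4 by simp
  moreover have "1 \<le> A * \<beta>" using \<beta>ge A by (simp add: field_simps)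
  ultimately have "pi / 2 * 1 \<le> A * (A * \<beta>)" using A by (intro mult_mono) auto
  then have "ln (pi / 2) \<le> ln (A * (A * \<beta>))" using A \<beta>0 by (intro ln_mono) auto
  also have "\<dots> = 2 * ln A + ln \<beta>" using A \<beta>0 by (simp add: ln_mult)
  finally have "4 / A * (ln (pi/2) - ln \<beta>) \<le> 4 / A * (2 * ln A)" using A by (intro mult_left_mono) auto
  moreover have "?\<tau> \<le> 4 / A * (ln (pi/2) - ln \<beta>)" using \<tau>1(1) \<tau>2(1) by (simp add: right_diff_distrib)
  ultimately have "?\<tau> + ?\<tau> \<le> 16 * ln A / A" by simp
  then show ?thesis using that full by blast
qed

text \<open>The displacement has size one period and is parallel to an axis. Moving left or vertically takes four quarter
  turns. The flow at \<open>x_f\<close> points left, so that moving right takes eight: two of them lead up to the edge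
  above, where the flow points right, and two lead back down at the end.\<close>

lemma reach_one_period:
  assumes "19 \<le> A" "0 \<le> \<mu>" "\<mu> \<le> 3/2" and j: "\<bar>j1\<bar> + \<bar>j2\<bar> = (1::int)"
  obtains \<tau> where "\<tau> \<le> 128 * ln A / A"
    "reach A \<mu> \<tau> x_f (x_f + vector [2 * pi * of_int j1, 2 * pi * of_int j2])"
proof -
  obtain \<tau> where \<tau>: "\<tau> \<le> 16 * ln A / A" and q: "reach A \<mu> \<tau> (vector [- pi/2, 0]) (vector [0, pi/2])"
    using reach_quarter_turn assms by metis
  have \<tau>0: "0 \<le> \<tau>" using reach_time_nonneg[OF q] .
  note S = reach_symmetry_coord
  \<comment> \<open>\<open>P\<close> moves one period to the right starting from \<open>(-\<pi>/2, 0)\<close>, and \<open>Q\<close> moves half a period up from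
    \<open>x_f\<close>; all routes are composed of images of these two.\<close>
  have q2: "reach A \<mu> \<tau> (vector [0, pi/2]) (vector [pi/2, pi])"
    using reach_swap[OF q] by (simp add: field_simps)
  have q3: "reach A \<mu> \<tau> (vector [pi/2, pi]) (vector [pi, pi/2])"
    using S[OF q, of 1 "-1" 1 1] by (simp add: field_simps)
  have q4: "reach A \<mu> \<tau> (vector [pi, pi/2]) (vector [3*pi/2, 0])"
    using S[OF q2, of 1 "-1" 1 1] by (simp add: field_simps)
  have P: "reach A \<mu> (4 * \<tau>) (vector [- pi/2, 0]) (vector [3*pi/2, 0])"
    using reach.trans[OF reach.trans[OF q q2] reach.trans[OF q3 q4]] by simp
  have q': "reach A \<mu> \<tau> (vector [pi/2, 0]) (vector [0, pi/2])"
    using S[OF q, of "-1" 1 0 0] by simp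
  have Q: "reach A \<mu> (2 * \<tau>) (vector [pi/2, 0]) (vector [pi/2, pi])"
    using reach.trans[OF q' q2] by simp
  have left: "reach A \<mu> (4 * \<tau>) (vector [pi/2, 0]) (vector [- 3*pi/2, 0])"
    using S[OF P, of "-1" 1 0 0] by simp
  have "reach A \<mu> (2 * \<tau>) (vector [pi/2, pi]) (vector [pi/2, 2 * pi])"
    using S[OF Q, of "-1" 1 1 1] by (simp add: field_simps)
  from reach.trans[OF Q this]
  have up: "reach A \<mu> (4 * \<tau>) (vector [pi/2, 0]) (vector [pi/2, 2 * pi])" by simp
  have down: "reach A \<mu> (4 * \<tau>) (vector [pi/2, 0]) (vector [pi/2, - 2 * pi])"
    using S[OF up, of 1 "-1" 0 0] by simp
  have r1: "reach A \<mu> (4 * \<tau>) (vector [pi/2, pi]) (vector [5*pi/2, pi])"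
    using S[OF P, of 1 1 1 1] by (simp add: field_simps)
  have r2: "reach A \<mu> (2 * \<tau>) (vector [5*pi/2, pi]) (vector [5*pi/2, 0])"
    using S[OF Q, of "-1" "-1" 3 1] by (simp add: field_simps)
  have right: "reach A \<mu> (8 * \<tau>) (vector [pi/2, 0]) (vector [5*pi/2, 0])"
    using reach.trans[OF Q reach.trans[OF r1 r2]] by simp
  have x: "x_f + vector [a, b] = vector [pi/2 + a, b]" for a b by (simp add: vec2_eq x_f_def)
  have b: "4 * \<tau> \<le> 128 * ln A / A" "8 * \<tau> \<le> 128 * ln A / A" using \<tau> \<tau>0 by auto
  consider "j1 = 1" "j2 = 0" | "j1 = -1" "j2 = 0" | "j1 = 0" "j2 = 1" | "j1 = 0" "j2 = -1"
    using j by linarith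
  then show ?thesis
  proof cases
    case 1 show ?thesis by (rule that[OF b(2)]) (use right 1 in \<open>simp add: x, simp add: x_f_def field_simps\<close>)
  next
    case 2 show ?thesis by (rule that[OF b(1)]) (use left 2 in \<open>simp add: x, simp add: x_f_def field_simps\<close>)
  next
    case 3 show ?thesis by (rule that[OF b(1)]) (use up 3 in \<open>simp add: x, simp add: x_f_def field_simps\<close>)
  next
    case 4 show ?thesis by (rule that[OF b(1)]) (use down 4 in \<open>simp add: x, simp add: x_f_def field_simps\<close>)
  qed
qed

section \<open>The lower bound on the segment\<close>

text \<open>The bound is the minimum of \<open>p \<bullet> x\<close> over the segment.\<close>

lemma lower_bound_on_segment:
  assumes sol: "planar_visc_solution (H_plus d A) p G" and p: "norm p = 1"
    and d: "0 < d" and \<mu>: "sqrt (1 + 4 * d\<^sup>2) < A * d"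
    and xD: "x \<in> D_seg (A * d)" and t: "0 \<le> t"
  shows "pi * p$1 - r_angle (A * d) * \<bar>p$1\<bar> \<le> G (x, t)"
proof -
  define \<mu>' r m where "\<mu>' = A * d" and "r = r_angle (A * d)" and "m = pi * p$1 - r_angle (A * d) * \<bar>p$1\<bar>"
  note ra = r_angle_bounds[OF d \<mu>, folded r_def, folded \<mu>'_def]
  have A0: "0 < A" using ra(1) d zero_less_mult_pos2[of A d] by (simp add: \<mu>'_def)
  have p1: "\<bar>p$1\<bar> \<le> 1" "\<bar>p$2\<bar> \<le> 1" using component_le_norm_cart[of p] p by simp_all
  define T where "T = t + 1"
  obtain B where B0: "0 \<le> B" and B: "\<And>x t. t \<in> {0..T} \<Longrightarrow> \<bar>G (x, t) - p \<bullet> x\<bar> \<le> B"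
    using planar_visc_solution_bounded[OF sol] by metis
  \<comment> \<open>half of the excess of the drift \<open>A sin r\<close> at the ends of the segment over the burning speed \<open>2\<close>\<close>
  define \<eta> where "\<eta> = (A * sin r - 2) / 2"
  have \<eta>: "0 < \<eta>" "A * sin r = 2 + 2 * \<eta>" using ra(5) by (simp_all add: \<eta>_def field_simps)
  \<comment> \<open>The barrier is compared only where \<open>x\<^sub>1\<close> is within \<open>\<delta>1\<close> of the interval and \<open>\<bar>x\<^sub>2\<bar> < \<delta>2\<close>. There
    \<open>\<Phi> \<le> 0\<close>, and beyond the ends of the interval the drift beats the burning speed by \<open>\<eta>\<close>.\<close>
  define \<delta>1 \<delta>2 where "\<delta>1 = pi / 2 - r" and "\<delta>2 = min 1 (\<eta> / (A * sin r))"
  have \<delta>: "0 < \<delta>1" "0 < \<delta>2" "\<delta>2 \<le> 1" "A * sin r * \<delta>2 \<le> \<eta>"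
    using ra \<eta> by (auto simp: \<delta>1_def \<delta>2_def field_simps min_le_iff_disj min_def)
  \<comment> \<open>collects the constants in \<open>m - G (y, \<tau>) < c + s + \<bar>y\<^sub>2\<bar>\<close>, where \<open>s\<close> is the distance of \<open>y\<^sub>1\<close> from the
    interval\<close>
  define c where "c = B + pi + r + \<bar>m\<bar> + 1"
  have c0: "0 \<le> c" using B0 ra by (simp add: c_def)
  define s1 s2 where "s1 y = max (y - pi - r) 0" and "s2 y = max (- (y - pi) - r) 0" for y :: real
  define \<rho> where "\<rho> = 2 * \<mu>' + 2 * A"
  have \<rho>0: "\<rho> \<ge> 0" using A0 ra(1) by (simp add: \<rho>_def)
  have key: "- G (x, t) \<le> - m + \<epsilon> + \<epsilon> * t" if \<epsilon>: "0 < \<epsilon>" for \<epsilon>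
  proof -
    \<comment> \<open>The first three summands in \<open>K\<close> and \<open>M\<close> push the barrier below \<open>G\<close> outside the comparison
      region, and the fourth does so everywhere at time \<open>0\<close>. The last summand of \<open>M\<close> makes the drift in the first coordinate
      dominate the mixed term, in which the distance from the interval is multiplied by \<open>\<bar>x\<^sub>2\<bar>\<close>.\<close>
    define K where "K = c / \<delta>2\<^sup>2 + 1 / \<delta>2 + 1 + 1 / (2 * \<epsilon>)"
    have K: "1 \<le> K" "c / \<delta>2\<^sup>2 + 1 / \<delta>2 \<le> K" "1 / (2 * \<epsilon>) \<le> K"
      using c0 \<delta> \<epsilon> by (simp_all add: K_def)
    define E where "E t = K * exp (\<rho> * t)" for t
    define M where "M = c / \<delta>1\<^sup>2 + 1 / \<delta>1 + 1 + 1 / (2 * \<epsilon>) + E T * \<mu>' * \<delta>2 / \<eta>"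
    have ET: "0 \<le> E T * \<mu>' * \<delta>2" using K ra(1) \<delta> by (simp add: E_def)
    have M: "1 \<le> M" "c / \<delta>1\<^sup>2 + 1 / \<delta>1 \<le> M" "1 / (2 * \<epsilon>) \<le> M" "E T * \<mu>' * \<delta>2 / \<eta> \<le> M"
      using c0 \<delta> \<epsilon> \<eta> divide_nonneg_pos[OF ET \<eta>(1)] by (simp_all add: M_def)
    have M': "E T * \<mu>' * \<delta>2 \<le> M * \<eta>" using M(4) \<eta> by (simp add: field_simps)
    have EK: "K \<le> E t" if "0 \<le> t" for t using K \<rho>0 that by (simp add: E_def)
    have E0: "0 < E t" for t using K by (simp add: E_def)
    \<comment> \<open>the negative of the barrier, since the comparison is applied to the subsolution \<open>- G\<close>\<close>
    define \<phi> where "\<phi> z = - m + \<epsilon> + \<epsilon> * snd z + M * ((s1 (fst z $ 1))\<^sup>2 + (s2 (fst z $ 1))\<^sup>2) + E (snd z) * (fst z $ 2)\<^sup>2"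
      for z :: "(real^2) \<times> real"
    define g where "g z = (vector [2 * M * (s1 (fst z $ 1) - s2 (fst z $ 1)), 2 * E (snd z) * fst z $ 2] :: real^2)"
      for z :: "(real^2) \<times> real"
    define h where "h z = \<epsilon> + \<rho> * E (snd z) * (fst z $ 2)\<^sup>2" for z :: "(real^2) \<times> real"
    \<comment> \<open>the distance of \<open>y\<close> from \<open>[\<pi> - r, \<pi> + r]\<close>; at most one of the two summands is positive\<close>
    define s where "s y = s1 y + s2 y" for y
    have s_sq: "(s1 y)\<^sup>2 + (s2 y)\<^sup>2 = (s y)\<^sup>2" "\<bar>s1 y - s2 y\<bar> = s y" "0 \<le> s y" "\<bar>y - pi\<bar> \<le> r + s y"
      "s y \<noteq> 0 \<Longrightarrow> \<bar>y - pi\<bar> = r + s y" for y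
      using ra(2) by (auto simp: s_def s1_def s2_def max_def)
    have localized: "s (y$1) < \<delta>1 \<and> \<bar>y$2\<bar> < \<delta>2" if tau: "\<tau> \<in> {0..T}" and lt: "\<phi> (y, \<tau>) < - G (y, \<tau>)" for y \<tau>
    proof -
      have "- (p \<bullet> y) \<le> \<bar>y$1\<bar> + \<bar>y$2\<bar>"
        using norm_cauchy_schwarz[of "- p" y] p norm_le_abs2[of y] by simp
      moreover have "\<bar>y$1\<bar> \<le> pi + r + s (y$1)" using s_sq(4)[of "y$1"] pi_gt_zero by linarith
      moreover have "0 \<le> \<epsilon> + \<epsilon> * \<tau>" using \<epsilon> tau by simp
      moreover have "K * (y$2)\<^sup>2 \<le> E \<tau> * (y$2)\<^sup>2" using EK tau by (intro mult_right_mono) auto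
      ultimately have lt': "M * (s (y$1))\<^sup>2 + K * \<bar>y$2\<bar>\<^sup>2 + 1 < c + s (y$1) + \<bar>y$2\<bar>"
        using lt B[OF tau, of y] unfolding \<phi>_def c_def by (simp add: s_sq(1))
      have sq: "z \<le> N * z\<^sup>2 + 1" if "1 \<le> N" "0 \<le> z" for N z :: real
      proof -
        have "z \<le> z\<^sup>2 + 1" using sum_squares_bound[of z 1] that by simp
        also have "\<dots> \<le> N * z\<^sup>2 + 1" using that mult_right_mono[of 1 N "z\<^sup>2"] by simp
        finally show ?thesis .
      qed
      show ?thesis
      proof (rule conjI; rule ccontr)
        assume "\<not> s (y$1) < \<delta>1"
        then have "c + s (y$1) \<le> M * (s (y$1))\<^sup>2"
          using c0 \<delta>(1) M(2) by (intro quadratic_dominates) auto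
        with lt' sq[OF K(1), of "\<bar>y$2\<bar>"] show False by simp
      next
        assume "\<not> \<bar>y$2\<bar> < \<delta>2"
        then have "c + \<bar>y$2\<bar> \<le> K * \<bar>y$2\<bar>\<^sup>2"
          using c0 \<delta>(2) K(2) by (intro quadratic_dominates) auto
        with lt' sq[OF M(1) s_sq(3), of "y$1"] show False by simp
      qed
    qed
    have "- G (x, t) \<le> \<phi> (x, t)"
    proof (rule comparison_below_barrier[of "\<lambda>z. - G z" "\<lambda>x q. - H_plus d A x (- q)" \<phi> g h 0 T "pi + r + \<delta>1 + \<delta>2"])
      show "continuous_on (UNIV \<times> {0..}) (\<lambda>z. - G z)"
        using sol by (auto simp: planar_visc_solution_def intro: continuous_on_minus)
      show "visc_subsolution (\<lambda>x q. - H_plus d A x (- q)) (\<lambda>z. - G z)"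
        using sol by (intro visc_subsolution_minus) (simp add: planar_visc_solution_def visc_solution_def)
      have cont_s: "continuous_on S (\<lambda>z. s1 (fst z $ 1))" "continuous_on S (\<lambda>z. s2 (fst z $ 1))" for S :: "((real^2) \<times> real) set"
        unfolding s1_def s2_def by (intro continuous_intros)+
      show "C1_with pos_time \<phi> g h"
        unfolding C1_with_def
      proof (intro conjI ballI)
        show "continuous_on pos_time g"
          unfolding g_def E_def vector_2_eq_axes by (auto intro!: continuous_intros cont_s)
        show "continuous_on pos_time h" unfolding h_def E_def by (intro continuous_intros)
        fix z :: "(real^2) \<times> real"
        have d1: "((\<lambda>z. fst z $ i) has_derivative (\<lambda>w. fst w $ i)) (at z)" for i
          by (rule bounded_linear.has_derivative[OF bounded_linear_vec_nth has_derivative_fst[OF has_derivative_ident]])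
        have ds1: "((\<lambda>z. (s1 (fst z $ 1))\<^sup>2) has_derivative (\<lambda>w. 2 * s1 (fst z $ 1) * fst w $ 1)) (at z)"
        proof -
          have "((\<lambda>z. fst z $ 1 - pi - r) has_derivative (\<lambda>w. fst w $ 1)) (at z)"
            by (auto intro!: derivative_eq_intros d1)
          from has_derivative_compose[OF this DERIV_max_zero_power2[unfolded has_field_derivative_def]]
          show ?thesis by (simp add: s1_def)
        qed
        have ds2: "((\<lambda>z. (s2 (fst z $ 1))\<^sup>2) has_derivative (\<lambda>w. 2 * s2 (fst z $ 1) * - fst w $ 1)) (at z)"
        proof -
          have "((\<lambda>z. - (fst z $ 1 - pi) - r) has_derivative (\<lambda>w. - fst w $ 1)) (at z)"
            by (auto intro!: derivative_eq_intros d1)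
          from has_derivative_compose[OF this DERIV_max_zero_power2[unfolded has_field_derivative_def]]
          show ?thesis by (simp add: s2_def)
        qed
        have dE: "((\<lambda>z. E (snd z)) has_derivative (\<lambda>w. \<rho> * E (snd z) * snd w)) (at z)"
          unfolding E_def by (auto intro!: derivative_eq_intros simp: fun_eq_iff)
        show "(\<phi> has_derivative (\<lambda>(y, s). g z \<bullet> y + h z * s)) (at z)"
          unfolding \<phi>_def
          by (rule has_derivative_eq_rhs, (rule derivative_intros dE d1 ds1 ds2)+)
            (auto simp: fun_eq_iff g_def h_def inner_vec2 algebra_simps power2_eq_square)
      qed
      show "continuous_on (UNIV \<times> {0..}) \<phi>"
        unfolding \<phi>_def E_def by (intro continuous_intros cont_s)
      show "0 \<le> (0::real)" "0 \<le> t" "t < T" using t by (auto simp: T_def)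
      show "- G (y, 0) \<le> \<phi> (y, 0)" for y
      proof -
        have G0: "G (y, 0) = p$1 * y$1 + p$2 * y$2"
          using sol by (simp add: planar_visc_solution_def inner_vec2)
        have "- (p$1 * (y$1 - pi)) \<le> \<bar>p$1\<bar> * \<bar>y$1 - pi\<bar>"
          using abs_ge_minus_self[of "p$1 * (y$1 - pi)"] by (simp add: abs_mult)
        also have "\<dots> \<le> \<bar>p$1\<bar> * (r + s (y$1))" by (intro mult_left_mono s_sq) simp
        also have "\<dots> \<le> \<bar>p$1\<bar> * r + s (y$1)"
          using mult_right_mono[OF p1(1) s_sq(3)[of "y$1"]] by (simp add: distrib_left)
        finally have "- (p$1 * y$1) \<le> - m + s (y$1)"
          by (simp add: m_def r_def algebra_simps)
        moreover have "- (p$2 * y$2) \<le> \<bar>y$2\<bar>"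
          using abs_ge_minus_self[of "p$2 * y$2"] mult_right_mono[OF p1(2), of "\<bar>y$2\<bar>"] by (simp add: abs_mult)
        moreover have "s (y$1) \<le> \<epsilon> / 2 + M * (s (y$1))\<^sup>2" "\<bar>y$2\<bar> \<le> \<epsilon> / 2 + K * \<bar>y$2\<bar>\<^sup>2"
          using linear_le_quadratic \<epsilon> M(3) K(3) by blast+
        ultimately show ?thesis by (simp add: \<phi>_def G0 s_sq(1) E_def)
      qed
      show "- G (y, \<tau>) \<le> \<phi> (y, \<tau>)" if "0 \<le> \<tau>" "\<tau> \<le> T" "pi + r + \<delta>1 + \<delta>2 \<le> norm y" for y \<tau>
      proof (rule ccontr)
        assume "\<not> - G (y, \<tau>) \<le> \<phi> (y, \<tau>)"
        then have "s (y$1) < \<delta>1 \<and> \<bar>y$2\<bar> < \<delta>2" using localized that by simp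
        moreover have "\<bar>y$1\<bar> \<le> pi + r + s (y$1)" using s_sq(4)[of "y$1"] pi_gt_zero by linarith
        ultimately show False using that(3) norm_le_abs2[of y] by linarith
      qed
      show "0 < h (y, \<tau>) + - H_plus d A y (- g (y, \<tau>))" if tau: "0 < \<tau>" "\<tau> < T" and lt: "\<phi> (y, \<tau>) < - G (y, \<tau>)" for y \<tau>
      proof -
        define \<xi> z \<sigma> where "\<xi> = y$1 - pi" and "z = y$2" and "\<sigma> = s (y$1)"
        define q where "q = - g (y, \<tau>)"
        have loc: "\<sigma> < \<delta>1" "\<bar>z\<bar> < \<delta>2" using localized[of \<tau> y] lt tau by (auto simp: \<sigma>_def z_def)
        have \<sigma>0: "0 \<le> \<sigma>" using s_sq by (simp add: \<sigma>_def)
        have \<xi>: "\<bar>\<xi>\<bar> \<le> r + \<sigma>" "r + \<sigma> \<le> pi / 2" "\<sigma> \<noteq> 0 \<Longrightarrow> \<bar>\<xi>\<bar> = r + \<sigma>"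
          using s_sq(4,5)[of "y$1"] loc by (auto simp: \<xi>_def \<sigma>_def \<delta>1_def)
        have trig: "cos (y$1) = - cos \<xi>" "sin (y$1) = - sin \<xi>" by (simp_all add: \<xi>_def cos_diff sin_diff)
        have cx0: "0 \<le> cos \<xi>" using \<xi> by (intro cos_ge_zero) auto
        have cz: "1 - \<bar>z\<bar> \<le> cos z" using abs_cos_diff_le[of 0 z] by simp
        have cz0: "0 \<le> cos z" using cz loc \<delta> by linarith
        have q1: "\<bar>q$1\<bar> = 2 * M * \<sigma>" and q2: "q$2 = - 2 * E \<tau> * z"
          using M s_sq(2)[of "y$1"] by (simp_all add: q_def g_def \<sigma>_def z_def abs_mult abs_minus_commute)
        have q1': "q$1 = - 2 * M * (s1 (y$1) - s2 (y$1))" by (simp add: q_def g_def)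
        define w where "w = cos \<xi> * cos z"
        have w: "0 \<le> w" using cx0 cz0 by (simp add: w_def)
        have "\<bar>q$1\<bar> * (1 + A * d * w) + cell_flow A y $ 1 * q$1 \<le> - 2 * M * \<eta> * \<sigma>"
        proof (cases "\<sigma> = 0")
          case True
          then have "q$1 = 0" using q1 by simp
          then show ?thesis using True by simp
        next
          case False
          then have \<xi>': "\<bar>\<xi>\<bar> = r + \<sigma>" by (rule \<xi>)
          have "cos \<bar>\<xi>\<bar> \<le> cos r" using \<xi>' \<xi>(2) \<sigma>0 ra by (intro cos_monotone_0_pi_le) auto
          then have "\<mu>' * cos \<xi> \<le> 1" using mult_left_mono[of "cos \<xi>" "cos r" \<mu>'] ra(1,4) by simp
          moreover have "w \<le> cos \<xi>" using cx0 by (simp add: w_def mult_left_le)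
          then have "\<mu>' * w \<le> \<mu>' * cos \<xi>" using ra(1) by (intro mult_left_mono) auto
          ultimately have "\<mu>' * w \<le> 1" by linarith
          then have 1: "\<bar>q$1\<bar> * (1 + A * d * w) \<le> 2 * M * \<sigma> * 2"
            unfolding q1 using M \<sigma>0 by (intro mult_left_mono) (auto simp: \<mu>'_def)
          have "sin r \<le> sin \<bar>\<xi>\<bar>" using \<xi>' \<xi>(2) \<sigma>0 ra by (intro sin_monotone_2pi_le) auto
          moreover have "sin \<xi> * (s1 (y$1) - s2 (y$1)) = sin \<bar>\<xi>\<bar> * \<sigma>"
            using \<xi>' ra(2) \<sigma>0 by (auto simp: \<sigma>_def s_def s1_def s2_def \<xi>_def max_def abs_if algebra_simps)
          ultimately have sx: "sin r * \<sigma> \<le> sin \<xi> * (s1 (y$1) - s2 (y$1))"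
            using mult_right_mono[OF _ \<sigma>0] by simp
          have "A * sin r * \<bar>z\<bar> \<le> A * sin r * \<delta>2" using loc \<eta> by (intro mult_left_mono) auto
          then have "2 + \<eta> \<le> A * sin r - A * sin r * \<bar>z\<bar>" using \<delta>(4) \<eta>(2) by linarith
          then have "2 + \<eta> \<le> A * sin r * (1 - \<bar>z\<bar>)" by (simp only: right_diff_distrib mult_1_right)
          also have "\<dots> \<le> A * sin r * cos z" using \<eta> by (intro mult_left_mono cz) simp
          finally have "(2 + \<eta>) * \<sigma> \<le> A * sin r * cos z * \<sigma>" by (rule mult_right_mono) (rule \<sigma>0)
          also have "\<dots> = A * cos z * (sin r * \<sigma>)" by simp
          also have "\<dots> \<le> A * cos z * (sin \<xi> * (s1 (y$1) - s2 (y$1)))"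
            using A0 cz0 by (intro mult_left_mono sx) simp
          finally have "2 * M * ((2 + \<eta>) * \<sigma>) \<le> 2 * M * (A * cos z * (sin \<xi> * (s1 (y$1) - s2 (y$1))))"
            using M by (intro mult_left_mono) auto
          also have "\<dots> = - (cell_flow A y $ 1 * q$1)"
            by (simp add: q1' trig z_def)
          finally show ?thesis using 1 by (simp add: algebra_simps)
        qed
        moreover have "\<bar>q$2\<bar> * max (1 - A * d * w) 0 \<le> 2 * M * \<eta> * \<sigma> + 2 * \<mu>' * E \<tau> * z\<^sup>2"
        proof -
          have "cos r - \<sigma> \<le> cos (r + \<sigma>)" using abs_cos_diff_le[of r "r + \<sigma>"] \<sigma>0 by simp
          also have "\<dots> \<le> cos \<bar>\<xi>\<bar>" using \<xi> pi_gt_zero by (intro cos_monotone_0_pi_le) auto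
          finally have "cos r - \<sigma> \<le> cos \<xi>" by simp
          moreover have "cos \<xi> - \<bar>z\<bar> \<le> w"
            using mult_left_mono[OF cz cx0] mult_right_mono[OF cos_le_one[of \<xi>], of "\<bar>z\<bar>"]
            by (simp add: w_def right_diff_distrib)
          ultimately have "\<mu>' * (cos r - \<sigma> - \<bar>z\<bar>) \<le> \<mu>' * w" using ra(1) by (intro mult_left_mono) auto
          then have "1 - A * d * w \<le> \<mu>' * (\<sigma> + \<bar>z\<bar>)"
            using ra(4) by (simp add: algebra_simps \<mu>'_def)
          moreover have "0 \<le> \<mu>' * (\<sigma> + \<bar>z\<bar>)" using ra(1) \<sigma>0 by simp
          ultimately have "\<bar>q$2\<bar> * max (1 - A * d * w) 0 \<le> \<bar>q$2\<bar> * (\<mu>' * (\<sigma> + \<bar>z\<bar>))"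
            by (intro mult_left_mono) auto
          also have "\<dots> = 2 * (E \<tau> * \<mu>' * \<bar>z\<bar>) * \<sigma> + 2 * \<mu>' * E \<tau> * z\<^sup>2"
            using E0[of \<tau>] by (simp add: q2 abs_mult algebra_simps power2_eq_square)
          also have "\<dots> \<le> 2 * (M * \<eta>) * \<sigma> + 2 * \<mu>' * E \<tau> * z\<^sup>2"
          proof -
            have "E \<tau> \<le> E T" using K \<rho>0 tau by (auto simp: E_def intro!: mult_left_mono)
            then have "E \<tau> * \<mu>' * \<bar>z\<bar> \<le> E T * \<mu>' * \<delta>2"
              using ra(1) loc E0[of T] by (intro mult_mono) auto
            then have "E \<tau> * \<mu>' * \<bar>z\<bar> \<le> M * \<eta>" using M' by simp
            then show ?thesis using \<sigma>0 by (intro add_right_mono mult_right_mono) auto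
          qed
          finally show ?thesis by (simp add: algebra_simps)
        qed
        moreover have "cell_flow A y $ 2 * q$2 \<le> 2 * A * E \<tau> * z\<^sup>2"
        proof -
          have "cos \<xi> * (z * sin z) \<le> \<bar>cos \<xi>\<bar> * (\<bar>z\<bar> * \<bar>sin z\<bar>)"
            using abs_ge_self[of "cos \<xi> * (z * sin z)"] by (simp add: abs_mult)
          also have "\<dots> \<le> 1 * (\<bar>z\<bar> * \<bar>z\<bar>)"
            by (intro mult_mono mult_left_mono abs_sin_x_le_abs_x abs_cos_le_one) auto
          finally have "2 * A * E \<tau> * (cos \<xi> * (z * sin z)) \<le> 2 * A * E \<tau> * z\<^sup>2"
            using A0 E0[of \<tau>] by (intro mult_left_mono) (auto simp: power2_eq_square)
          then show ?thesis by (simp add: q2 trig z_def[symmetric] mult_ac)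
        qed
        moreover have "H_plus d A y q \<le> \<bar>q$1\<bar> * (1 + A * d * w) + \<bar>q$2\<bar> * max (1 - A * d * w) 0 + cell_flow A y \<bullet> q"
        proof -
          have "- (cos (y$1) * cos (y$2)) = w" by (simp add: trig w_def z_def)
          then show ?thesis using H_plus_le_anisotropic[of A d y q] w ra(1) by (simp add: \<mu>'_def)
        qed
        ultimately have "H_plus d A y q \<le> \<rho> * E \<tau> * z\<^sup>2"
          by (simp add: inner_vec2 \<rho>_def algebra_simps del: cell_flow_nth)
        then show ?thesis using \<epsilon> by (simp add: h_def q_def z_def)
      qed
    qed
    moreover have "s1 (x$1) = 0" "s2 (x$1) = 0" "x$2 = 0"
      using xD by (auto simp: s1_def s2_def D_seg_def r_def)
    ultimately show ?thesis by (simp add: \<phi>_def)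
  qed
  have "- G (x, t) \<le> - m"
  proof (rule field_le_epsilon)
    fix e :: real assume e: "0 < e"
    have p: "1 + t > 0" using t by simp
    then have "- G (x, t) \<le> - m + e / (1 + t) * (1 + t)"
      using key[of "e / (1 + t)"] e by (simp add: distrib_left)
    then show "- G (x, t) \<le> - m + e" using p by simp
  qed
  then show ?thesis by (simp add: m_def)
qed

section \<open>Linear decay at the edge midpoint\<close>

lemma nonincreasing_along_reach:
  assumes sol: "planar_visc_solution (H_plus d A) p G" and p: "norm p = 1"
    and dA: "0 \<le> d" "0 \<le> A"
    and "reach A (A * d) \<tau> x y"
  shows "0 \<le> t \<Longrightarrow> G (y, t + \<tau>) \<le> G (x, t)"
  using assms(5)
proof (induction arbitrary: t)
  case (path \<tau> \<gamma> v x y)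
  let ?\<mu> = "A * d"
  have adm: "0 \<le> \<tau>" "continuous_on {0..\<tau>} v"
    "\<And>s. s \<in> {0..\<tau>} \<Longrightarrow> (\<gamma> has_vector_derivative v s) (at s within {0..\<tau>})"
    "\<And>s. s \<in> {0..\<tau>} \<Longrightarrow> norm (v s - cell_flow A (\<gamma> s)) \<le> iso_speed ?\<mu> (\<gamma> s)"
    using path by (auto simp: admissible_path_def)
  have \<mu>: "0 \<le> ?\<mu>" using dA by simp
  have "G (\<gamma> \<tau>, t + \<tau>) \<le> G (\<gamma> 0, t)"
  proof (rule subsolution_nonincreasing_along_curve[where H = "H_plus d A" and v = v and L = "4 * A + 2 * ?\<mu>"])
    show "continuous_on (UNIV \<times> {0..}) G" "visc_subsolution (H_plus d A) G"
      using sol by (auto simp: planar_visc_solution_def visc_solution_def)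
    show "\<exists>B. \<forall>x. \<forall>t\<in>{0..T}. G (x, t) \<le> B + norm x" for T
    proof -
      obtain B where B: "\<And>x t. t \<in> {0..T} \<Longrightarrow> \<bar>G (x, t) - p \<bullet> x\<bar> \<le> B"
        using planar_visc_solution_bounded[OF sol] by metis
      have "G (x, t) \<le> B + norm x" if "t \<in> {0..T}" for x t
        using B[OF that, of x] norm_cauchy_schwarz[of p x] p by simp
      then show ?thesis by blast
    qed
    show "0 \<le> 4 * A + 2 * ?\<mu>" using dA by simp
    fix s x q assume s: "s \<in> {0..\<tau>}"
    let ?n = "norm (x - \<gamma> s)"
    have "v s \<bullet> q = (v s - cell_flow A (\<gamma> s)) \<bullet> q + (cell_flow A (\<gamma> s) - cell_flow A x) \<bullet> q + cell_flow A x \<bullet> q"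
      by (simp add: inner_diff_left)
    also have "\<dots> \<le> (iso_speed ?\<mu> x + 2 * ?\<mu> * ?n) * norm q + (4 * A * ?n) * norm q + cell_flow A x \<bullet> q"
    proof (intro add_mono order_refl)
      have "iso_speed ?\<mu> (\<gamma> s) \<le> iso_speed ?\<mu> x + 2 * ?\<mu> * ?n"
        using iso_speed_Lipschitz[OF \<mu>, of x "\<gamma> s"] by linarith
      then have "norm (v s - cell_flow A (\<gamma> s)) * norm q \<le> (iso_speed ?\<mu> x + 2 * ?\<mu> * ?n) * norm q"
        using adm(4)[OF s] by (intro mult_right_mono) auto
      then show "(v s - cell_flow A (\<gamma> s)) \<bullet> q \<le> (iso_speed ?\<mu> x + 2 * ?\<mu> * ?n) * norm q"
        using norm_cauchy_schwarz order_trans by blast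
      have "norm (cell_flow A (\<gamma> s) - cell_flow A x) \<le> 4 * A * ?n"
        using cell_flow_Lipschitz[of A "\<gamma> s" x] dA by (simp add: norm_minus_commute)
      then have "norm (cell_flow A (\<gamma> s) - cell_flow A x) * norm q \<le> 4 * A * ?n * norm q"
        by (rule mult_right_mono) simp
      then show "(cell_flow A (\<gamma> s) - cell_flow A x) \<bullet> q \<le> 4 * A * ?n * norm q"
        using norm_cauchy_schwarz order_trans by blast
    qed
    also have "\<dots> = iso_speed ?\<mu> x * norm q + cell_flow A x \<bullet> q + (4 * A + 2 * ?\<mu>) * ?n * norm q"
      by (simp add: algebra_simps)
    also have "\<dots> \<le> H_plus d A x q + (4 * A + 2 * ?\<mu>) * ?n * norm q"
      using H_plus_ge_isotropic[OF dA(2,1), of x q] by simp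
    finally show "v s \<bullet> q - (4 * A + 2 * ?\<mu>) * ?n * norm q \<le> H_plus d A x q" by simp
  qed (use adm path in auto)
  then show ?case using path by simp
next
  case (trans \<tau> x y \<sigma> z)
  have "G (z, (t + \<tau>) + \<sigma>) \<le> G (y, t + \<tau>)"
    using trans reach_time_nonneg[of A "A * d" \<tau> x y] by simp
  also have "\<dots> \<le> G (x, t)" using trans by simp
  finally show ?case by (simp add: add.assoc)
qed

lemma decay_at_edge_midpoint:
  assumes sol: "planar_visc_solution (H_plus d A) p G" and p: "norm p = 1"
    and d: "0 \<le> d" and A: "19 \<le> A" and \<mu>: "A * d \<le> 3/2"
  obtains a b where "1/64 * (A / ln A) \<le> a" "\<And>t. 0 \<le> t \<Longrightarrow> G (x_f, t) \<le> b - a * t"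
proof -
  have psum: "(p$1)\<^sup>2 + (p$2)\<^sup>2 = 1" using norm_power2_vec2[of p] p by simp
  obtain j1 j2 :: int where j: "\<bar>j1\<bar> + \<bar>j2\<bar> = 1" "1/2 \<le> p$1 * of_int j1 + p$2 * of_int j2"
  proof -
    have big: "1/2 \<le> \<bar>u\<bar>" if "1/2 \<le> u\<^sup>2" for u :: real
    proof (rule ccontr)
      assume "\<not> 1/2 \<le> \<bar>u\<bar>"
      then have "\<bar>u\<bar>\<^sup>2 \<le> (1/2)\<^sup>2" by (intro power_mono) auto
      then show False using that by (simp add: power2_eq_square)
    qed
    have "1/2 \<le> (p$1)\<^sup>2 \<or> 1/2 \<le> (p$2)\<^sup>2" using psum by linarith
    then consider "1/2 \<le> \<bar>p$1\<bar>" | "1/2 \<le> \<bar>p$2\<bar>" using big by blast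
    then show ?thesis
    proof cases
      case 1
      then have "1/2 \<le> p$1 \<or> 1/2 \<le> - p$1" by linarith
      then show ?thesis using that[of 1 0] that[of "-1" 0] by auto
    next
      case 2
      then have "1/2 \<le> p$2 \<or> 1/2 \<le> - p$2" by linarith
      then show ?thesis using that[of 0 1] that[of 0 "-1"] by auto
    qed
  qed
  define w where "w = (vector [2 * pi * of_int j1, 2 * pi * of_int j2] :: real^2)"
  obtain \<tau> where \<tau>: "\<tau> \<le> 128 * ln A / A" "reach A (A * d) \<tau> x_f (x_f + w)"
    using reach_one_period[OF A _ \<mu> j(1)] d A unfolding w_def by auto
  have pw: "pi \<le> p \<bullet> w"
    using mult_left_mono[OF j(2), of "2 * pi"] by (simp add: w_def inner_vec2 algebra_simps)
  have drop: "G (x_f, t + \<tau>) \<le> G (x_f, t) - pi" if "0 \<le> t" for t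
  proof -
    have "0 \<le> t + \<tau>" using reach_time_nonneg[OF \<tau>(2)] that by simp
    then have "periodic_2pi (\<lambda>x. G (x, t + \<tau>) - p \<bullet> x)"
      using sol unfolding planar_visc_solution_def by blast
    then have "G (x_f + w, t + \<tau>) - p \<bullet> (x_f + w) = G (x_f, t + \<tau>) - p \<bullet> x_f"
      unfolding periodic_2pi_def w_def by blast
    moreover have "G (x_f + w, t + \<tau>) \<le> G (x_f, t)"
      using nonincreasing_along_reach[OF sol p d _ \<tau>(2) that] A by simp
    ultimately show ?thesis using pw by (simp add: inner_add_right)
  qed
  have "\<tau> \<noteq> 0"
  proof
    assume "\<tau> = 0"
    then have "pi \<le> 0" using drop[of 0] by simp
    then show False using pi_gt_zero by linarith
  qed
  then have \<tau>0: "0 < \<tau>" using reach_time_nonneg[OF \<tau>(2)] by simp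
  obtain B where B: "\<And>x t. t \<in> {0..\<tau>} \<Longrightarrow> \<bar>G (x, t) - p \<bullet> x\<bar> \<le> B"
    using planar_visc_solution_bounded[OF sol] by metis
  have decay: "G (x_f, t) \<le> (B + p \<bullet> x_f) + pi - pi / \<tau> * t" if "0 \<le> t" for t
  proof (rule periodic_drop_imp_linear_decay[where h = "\<lambda>t. G (x_f, t)", OF \<tau>0 _ drop _ that])
    show "G (x_f, s) \<le> B + p \<bullet> x_f" if "s \<in> {0..\<tau>}" for s
      using B[OF that, of x_f] by simp
  qed simp_all
  have lnA: "0 < ln A" using A by simp
  have "1/64 * (A / ln A) = 2 / (128 * ln A / A)" using A lnA by simp
  also have "\<dots> \<le> pi / (128 * ln A / A)"
    using pi_ge_two A lnA by (intro divide_right_mono) auto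
  also have "\<dots> \<le> pi / \<tau>" using \<tau> \<tau>0 A lnA by (intro divide_left_mono mult_pos_pos) auto
  finally have "1/64 * (A / ln A) \<le> pi / \<tau>" .
  then show ?thesis by (rule that) (rule decay)
qed

section \<open>Absence of a phase-independent burning velocity\<close>

theorem theorem2p1:
  shows "\<exists>C>0. \<forall>(d::real) (A::real) (p::real^2) (G :: (real^2) \<times> real \<Rightarrow> real).
    0 < d \<and> d < 20/399 \<and> sqrt (1 + 4 * d\<^sup>2) < A * d \<and> A * d \<le> 1 + d / 10 \<and>
    norm p = 1 \<and> planar_visc_solution (H_plus d A) p G
    \<longrightarrow>
      (\<forall>x \<in> D_seg (A * d). \<forall>t\<ge>0. G (x, t) \<ge> pi * p$1 - r_angle (A * d) * \<bar>p$1\<bar>)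
    \<and> Liminf at_top (\<lambda>t. ereal (- (G (x_f, t) / t))) \<ge> ereal (C * (A / ln A))
    \<and> Liminf at_top (\<lambda>t. ereal (osc (\<lambda>x. G (x, t) - p \<bullet> x) / t)) \<ge> ereal (C * (A / ln A))
    \<and> \<not> (\<exists>Hbar::real. uniform_limit UNIV (\<lambda>t x. (G (x, t) - p \<bullet> x) / t) (\<lambda>x. - Hbar) at_top)"
proof (intro exI[of _ "1/64"] conjI allI impI)
  show "(0::real) < 1/64" by simp
  fix d A :: real and p :: "real^2" and G :: "(real^2) \<times> real \<Rightarrow> real"
  assume *: "0 < d \<and> d < 20/399 \<and> sqrt (1 + 4 * d\<^sup>2) < A * d \<and> A * d \<le> 1 + d / 10 \<and>
    norm p = 1 \<and> planar_visc_solution (H_plus d A) p G"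
  then have d: "0 < d" "d < 20/399" and \<mu>: "sqrt (1 + 4 * d\<^sup>2) < A * d" "A * d \<le> 1 + d / 10"
    and p: "norm p = 1" and sol: "planar_visc_solution (H_plus d A) p G" by blast+
  note ra = r_angle_bounds[OF d(1) \<mu>(1)]
  \<comment> \<open>since \<open>A d > 1\<close> and \<open>d < 20/399\<close>\<close>
  have A: "19 \<le> A"
  proof (rule ccontr)
    assume "\<not> 19 \<le> A"
    then have "A * d \<le> 19 * d" using d by (intro mult_right_mono) auto
    then show False using ra(1) d by linarith
  qed
  have "A * d \<le> 3/2" using \<mu> d by linarith
  then obtain a b where a: "1/64 * (A / ln A) \<le> a" and b: "\<And>t. 0 \<le> t \<Longrightarrow> G (x_f, t) \<le> b - a * t"
    using decay_at_edge_midpoint[OF sol p _ A] d by (metis less_imp_le)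
  have a0: "0 < a"
  proof -
    have "0 < 1/64 * (A / ln A)" using A by simp
    then show ?thesis using a by linarith
  qed
  have trap: "pi * p$1 - r_angle (A * d) * \<bar>p$1\<bar> \<le> G (x, t)" if "x \<in> D_seg (A * d)" "0 \<le> t" for x t
    using lower_bound_on_segment[OF sol p d(1) \<mu>(1) that] .
  then show "\<forall>x\<in>D_seg (A * d). \<forall>t\<ge>0. pi * p$1 - r_angle (A * d) * \<bar>p$1\<bar> \<le> G (x, t)" by blast
  have le_Liminf: "ereal (1/64 * (A / ln A)) \<le> Liminf at_top (\<lambda>t. ereal (f t))"
    if "\<And>t. 0 < t \<Longrightarrow> a - e / t \<le> f t" for f e
    using Liminf_at_top_ge[of a e f] that a by (meson ereal_less_eq(3) order_trans)
  show "ereal (1/64 * (A / ln A)) \<le> Liminf at_top (\<lambda>t. ereal (- (G (x_f, t) / t)))"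
  proof (rule le_Liminf)
    fix t :: real assume t: "0 < t"
    then have "(a * t - b) / t \<le> - G (x_f, t) / t" using b[of t] by (intro divide_right_mono) auto
    then show "a - b / t \<le> - (G (x_f, t) / t)" using t by (simp add: diff_divide_distrib)
  qed
  \<comment> \<open>the centre of the segment, where \<open>G\<close> stays bounded below\<close>
  define x0 where "x0 = (vector [pi, 0] :: real^2)"
  have x0: "- pi \<le> G (x0, t) - p \<bullet> x0" if "0 \<le> t" for t
  proof -
    have "x0 \<in> D_seg (A * d)" using ra by (simp add: x0_def D_seg_def)
    from trap[OF this that] have "- (r_angle (A * d) * \<bar>p$1\<bar>) \<le> G (x0, t) - p \<bullet> x0"
      by (simp add: x0_def inner_vec2 mult.commute)
    moreover have "r_angle (A * d) * \<bar>p$1\<bar> \<le> pi * 1"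
      using ra component_le_norm_cart[of p 1] p by (intro mult_mono) auto
    ultimately show ?thesis by simp
  qed
  show "ereal (1/64 * (A / ln A)) \<le> Liminf at_top (\<lambda>t. ereal (osc (\<lambda>x. G (x, t) - p \<bullet> x) / t))"
  proof (rule le_Liminf)
    fix t :: real assume t: "0 < t"
    let ?u = "\<lambda>x. G (x, t) - p \<bullet> x"
    obtain B where "\<And>x s. s \<in> {0..t} \<Longrightarrow> \<bar>G (x, s) - p \<bullet> x\<bar> \<le> B"
      using planar_visc_solution_bounded[OF sol] by metis
    then have "\<bar>?u x\<bar> \<le> B" for x using t by simp
    then have B: "?u x \<le> B" "- B \<le> ?u x" for x by (meson abs_le_D1 abs_le_D2 minus_le_iff)+
    have "bdd_above (range ?u)" "bdd_below (range ?u)"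
      using B by (auto intro!: bdd_aboveI2[of _ _ B] bdd_belowI2[of _ "- B"])
    then have "?u x0 \<le> (SUP x. ?u x)" "(INF x. ?u x) \<le> ?u x_f"
      by (auto intro: cSUP_upper cINF_lower)
    then have "?u x0 - ?u x_f \<le> osc ?u" unfolding osc_def by simp
    then have "a * t - (b + pi - p \<bullet> x_f) \<le> osc ?u" using x0[of t] b[of t] t by simp
    then have "(a * t - (b + pi - p \<bullet> x_f)) / t \<le> osc ?u / t" using t by (intro divide_right_mono) auto
    then show "a - (b + pi - p \<bullet> x_f) / t \<le> osc ?u / t" using t by (simp add: diff_divide_distrib)
  qed
  show "\<not> (\<exists>Hbar::real. uniform_limit UNIV (\<lambda>t x. (G (x, t) - p \<bullet> x) / t) (\<lambda>x. - Hbar) at_top)"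
  proof
    assume "\<exists>Hbar::real. uniform_limit UNIV (\<lambda>t x. (G (x, t) - p \<bullet> x) / t) (\<lambda>x. - Hbar) at_top"
    then obtain Hbar where "uniform_limit UNIV (\<lambda>t x. (G (x, t) - p \<bullet> x) / t) (\<lambda>x. - Hbar) at_top" by blast
    then have lim: "((\<lambda>t. (G (x, t) - p \<bullet> x) / t) \<longlongrightarrow> - Hbar) at_top" for x
      by (rule tendsto_uniform_limitI) simp
    have div0: "((\<lambda>t. c / t) \<longlongrightarrow> 0) at_top" for c :: real
      by (rule real_tendsto_divide_at_top[OF tendsto_const filterlim_ident])
    have "0 \<le> - Hbar"
    proof (rule tendsto_le[OF _ lim[of x0] div0[of "- pi"]])
      show "\<forall>\<^sub>F t in at_top. - pi / t \<le> (G (x0, t) - p \<bullet> x0) / t"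
        using eventually_gt_at_top[of 0] by eventually_elim (intro divide_right_mono x0, auto)
    qed simp
    moreover have "- Hbar \<le> 0 - a"
    proof (rule tendsto_le[OF _ tendsto_diff[OF div0[of "b - p \<bullet> x_f"] tendsto_const] lim[of x_f]])
      show "\<forall>\<^sub>F t in at_top. (G (x_f, t) - p \<bullet> x_f) / t \<le> (b - p \<bullet> x_f) / t - a"
        using eventually_gt_at_top[of 0]
      proof eventually_elim
        case (elim t)
        then have "(G (x_f, t) - p \<bullet> x_f) / t \<le> (b - p \<bullet> x_f - a * t) / t"
          using b[of t] by (intro divide_right_mono) auto
        then show ?case using elim by (simp add: diff_divide_distrib)
      qed
    qed simp
    ultimately show False using a0 by simp
  qed
qed

end
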